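(* Let $\alpha>0$ and let $\nu_1,\nu_2$ be two finite measures on $\mathbf{S}_+^{d-1}$ satisfying $\int u^j\,\mathrm d\nu_i(u)=1$ for all $j\in\{1,\dots,d\}$, $i=1,2$. Let $Z_i\sim\mathcal{MS}(\alpha,\nu_i)$ for $i=1,2$. (1) One has $$\mathrm d_{\mathrm K}(Z_1,Z_2)\le d\;\mathrm d_{\mathrm{TV}}(\nu_1,\nu_2).$$ (2) If furthermore $\alpha>1$, then $$\mathrm d_{\mathrm W}(Z_1,Z_2)\le d\,\Gamma\Big(1-\frac1\alpha\Big)\,\mathrm d_{\mathrm{TV}}(\nu_1,\nu_2).$$
   Context: Fix $d\ge 1$, $\mathbb{R}_+=[0,\infty)$. Operations on vectors (powers, inequalities) are coordinate-wise; $\|x\|_1=\sum_j|x^j|$. Let $E_0=[0,\infty)^d\setminus\{0\}$, $[0,x]=\prod_j[0,x^j]$ and $[0,x]^c$ its complement in $E_0$. Fix a norm $\|\cdot\|$ on $\mathbb{R}^d$ such that $\mathbf{S}_+^{d-1}=\{x\in\mathbb{R}_+^d:\|x\|=1\}\subseteq[0,1]^d$. For $\alpha>0$ and a finite measure $\nu$ on $\mathbf{S}_+^{d-1}$ with $\int u^j\mathrm d\nu(u)=1$ for all $j$, the exponent measure $\mu$ is the pushforward of $\alpha r^{-\alpha-1}\mathrm dr\otimes\nu(\mathrm du)$ on $(0,\infty)\times\mathbf{S}_+^{d-1}$ by $(r,u)\mapsto r\,u^{1/\alpha}$. $\mathcal{MS}(\alpha,\nu)$ is the law of the max-stable random vector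 $Z$ on $(0,\infty)^d$ with $\mathbb{P}(Z\le z)=e^{-\mu([0,z]^c)}$, $z\in(0,\infty)^d$. Distances: $\mathrm d_{\mathrm K}(X,Y)=\sup_{z\in(0,\infty)^d}|\mathbb{P}(X\le z)-\mathbb{P}(Y\le z)|$; $\mathrm d_{\mathrm W}(X,Y)=\sup_h|\mathbb{E}h(X)-\mathbb{E}h(Y)|$, the supremum being over $h:\mathbb{R}_+^d\to\mathbb{R}$ with $|h(x)-h(y)|\le\|x-y\|_1$ for all $x,y$; $\mathrm d_{\mathrm{TV}}(\nu_1,\nu_2)=\int_{\mathbf{S}_+^{d-1}}|f_{\nu_2}-f_{\nu_1}|\,\mathrm d(\nu_1+\nu_2)$ with $f_{\nu_i}=\mathrm d\nu_i/\mathrm d(\nu_1+\nu_2)$ (i.e. the total mass of $|\nu_1-\nu_2|$). *)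

theory Defs
  imports "HOL-Probability.Probability"
begin

text \<open>
  Vectors live in \<^typ>\<open>real ^ 'n\<close>, so the dimension is \<^term>\<open>CARD('n)\<close>. The order on this type is
  the coordinate-wise one for \<open>\<le>\<close> (and \<open>{0..z}\<close> is the box with corners \<open>0\<close> and \<open>z\<close>), but the library's
  strict order is not the coordinate-wise strict inequality, so open orthants are spelled out.
\<close>

definition nonneg_orthant :: "(real ^ 'n) set" where
  "nonneg_orthant = {x. \<forall>j. 0 \<le> x $ j}"

definition pos_orthant :: "(real ^ 'n) set" where
  "pos_orthant = {x. \<forall>j. 0 < x $ j}"

definition E0 :: "(real ^ 'n) set" where
  "E0 = nonneg_orthant - {0}"

definition norm1 :: "real ^ 'n::finite \<Rightarrow> real" where
  "norm1 x = (\<Sum>j\<in>UNIV. \<bar>x $ j\<bar>)"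

definition vec_powr :: "real ^ 'n \<Rightarrow> real \<Rightarrow> real ^ 'n" where
  "vec_powr x a = (\<chi> j. x $ j powr a)"

definition is_norm :: "('a::real_vector \<Rightarrow> real) \<Rightarrow> bool" where
  "is_norm N \<longleftrightarrow>
     (\<forall>x. 0 \<le> N x) \<and> (\<forall>x. N x = 0 \<longleftrightarrow> x = 0) \<and>
     (\<forall>c x. N (c *\<^sub>R x) = \<bar>c\<bar> * N x) \<and> (\<forall>x y. N (x + y) \<le> N x + N y)"

definition pos_sphere :: "(real ^ 'n \<Rightarrow> real) \<Rightarrow> (real ^ 'n) set" where
  "pos_sphere N = {x \<in> nonneg_orthant. N x = 1}"

definition angular_measure :: "(real ^ 'n::finite \<Rightarrow> real) \<Rightarrow> (real ^ 'n) measure \<Rightarrow> bool" where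
  "angular_measure N \<nu> \<longleftrightarrow>
     finite_measure \<nu> \<and> sets \<nu> = sets (restrict_space borel (pos_sphere N)) \<and>
     (\<forall>j. (\<integral>u. u $ j \<partial>\<nu>) = 1)"

definition radial_measure :: "real \<Rightarrow> real measure" where
  "radial_measure \<alpha> =
     density (restrict_space lborel {0<..}) (\<lambda>r. ennreal (\<alpha> * r powr (- \<alpha> - 1)))"

definition polar_map :: "real \<Rightarrow> real \<times> (real ^ 'n) \<Rightarrow> real ^ 'n" where
  "polar_map \<alpha> = (\<lambda>(r, u). r *\<^sub>R vec_powr u (1 / \<alpha>))"

definition exponent_measure :: "real \<Rightarrow> (real ^ 'n::finite) measure \<Rightarrow> (real ^ 'n) measure" where
  "exponent_measure \<alpha> \<nu> =
     distr (radial_measure \<alpha> \<Otimes>\<^sub>M \<nu>) (restrict_space borel E0) (polar_map \<alpha>)"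

text \<open>
  The real-valued \<^const>\<open>measure\<close> below is harmless: for an angular measure on a positive sphere
  contained in the unit cube, a point \<open>polar_map \<alpha> (r, u)\<close> outside \<open>{0..z}\<close> has \<open>r > z $ j\<close> for some
  \<open>j\<close>, so the exponent measure of the complement of the box is finite whenever \<open>z\<close> is in the open orthant.
\<close>

definition max_stable_rv ::
    "real \<Rightarrow> (real ^ 'n::finite) measure \<Rightarrow> 'a measure \<Rightarrow> ('a \<Rightarrow> real ^ 'n) \<Rightarrow> bool" where
  "max_stable_rv \<alpha> \<nu> M Z \<longleftrightarrow>
     Z \<in> measurable M (restrict_space borel pos_orthant) \<and>
     (\<forall>z\<in>pos_orthant.
        measure M {\<omega> \<in> space M. Z \<omega> \<le> z} = exp (- measure (exponent_measure \<alpha> \<nu>) (E0 - {0..z})))"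

definition kolmogorov_dist ::
    "'a measure \<Rightarrow> ('a \<Rightarrow> real ^ 'n::finite) \<Rightarrow> 'b measure \<Rightarrow> ('b \<Rightarrow> real ^ 'n) \<Rightarrow> real" where
  "kolmogorov_dist M X M' Y =
     (SUP z\<in>pos_orthant.
        \<bar>measure M {\<omega> \<in> space M. X \<omega> \<le> z} - measure M' {\<omega> \<in> space M'. Y \<omega> \<le> z}\<bar>)"

text \<open>
  Test functions are only constrained on the closed orthant; their values elsewhere are irrelevant
  for random vectors with values there. The supremum is extended-real because it may be infinite.
\<close>

definition lip1_functions :: "(real ^ 'n::finite \<Rightarrow> real) set" where
  "lip1_functions =
     {h. \<forall>x\<in>nonneg_orthant. \<forall>y\<in>nonneg_orthant. \<bar>h x - h y\<bar> \<le> norm1 (x - y)}"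

definition wasserstein_dist ::
    "'a measure \<Rightarrow> ('a \<Rightarrow> real ^ 'n::finite) \<Rightarrow> 'b measure \<Rightarrow> ('b \<Rightarrow> real ^ 'n) \<Rightarrow> ereal" where
  "wasserstein_dist M X M' Y =
     (SUP h\<in>lip1_functions. ereal \<bar>(\<integral>\<omega>. h (X \<omega>) \<partial>M) - (\<integral>\<omega>. h (Y \<omega>) \<partial>M')\<bar>)"

definition sum_measure :: "'a measure \<Rightarrow> 'a measure \<Rightarrow> 'a measure" where
  "sum_measure M N = measure_of (space M) (sets M) (\<lambda>A. emeasure M A + emeasure N A)"

definition tv_dist :: "'a measure \<Rightarrow> 'a measure \<Rightarrow> real" where
  "tv_dist \<nu>\<^sub>1 \<nu>\<^sub>2 =
     (let S = sum_measure \<nu>\<^sub>1 \<nu>\<^sub>2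
      in \<integral>u. \<bar>enn2real (RN_deriv S \<nu>\<^sub>2 u) - enn2real (RN_deriv S \<nu>\<^sub>1 u)\<bar> \<partial>S)"

lemma sets_sum_measure [simp]: "sets (sum_measure M N) = sets M"
  by (simp add: sum_measure_def)

lemma space_sum_measure [simp]: "space (sum_measure M N) = space M"
  by (simp add: sum_measure_def)

text \<open>The set function defining \<^const>\<open>sum_measure\<close> and the push-forward defining
  \<^const>\<open>exponent_measure\<close> are the intended ones, not default values:\<close>

lemma emeasure_sum_measure:
  assumes "sets N = sets M" and "A \<in> sets M"
  shows "emeasure (sum_measure M N) A = emeasure M A + emeasure N A"
proof (rule emeasure_measure_of[OF sum_measure_def])
  show "sets M \<subseteq> Pow (space M)" by (rule sets.space_closed)
  show "A \<in> sets (sum_measure M N)" using assms by simp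
  show "positive (sets (sum_measure M N)) (\<lambda>A. emeasure M A + emeasure N A)"
    by (simp add: positive_def)
  show "countably_additive (sets (sum_measure M N)) (\<lambda>A. emeasure M A + emeasure N A)"
  proof (rule countably_additiveI)
    fix F :: "nat \<Rightarrow> 'a set"
    assume F: "range F \<subseteq> sets (sum_measure M N)" "disjoint_family F"
    have "(\<Sum>i. emeasure M (F i) + emeasure N (F i)) = (\<Sum>i. emeasure M (F i)) + (\<Sum>i. emeasure N (F i))"
      by (rule suminf_add[symmetric]) auto
    then show "(\<Sum>i. emeasure M (F i) + emeasure N (F i)) = emeasure M (\<Union>(range F)) + emeasure N (\<Union>(range F))"
      using F assms by (simp add: suminf_emeasure)
  qed
qed

lemma measurable_polar_map:
  fixes N :: "real ^ 'n::finite \<Rightarrow> real"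
  assumes "is_norm N" and "angular_measure N \<nu>"
  shows "polar_map \<alpha> \<in> measurable (radial_measure \<alpha> \<Otimes>\<^sub>M \<nu>) (restrict_space borel E0)"
proof -
  have sp: "space \<nu> = pos_sphere N" and s: "sets \<nu> = sets (restrict_space borel (pos_sphere N))"
    using assms(2) sets_eq_imp_space_eq[of \<nu> "restrict_space borel (pos_sphere N)"]
    by (auto simp: angular_measure_def space_restrict_space)
  have 1: "(\<lambda>r. r) \<in> borel_measurable (radial_measure \<alpha>)"
    by (simp add: radial_measure_def measurable_restrict_space1)
  have "(\<lambda>u. u) \<in> borel_measurable (restrict_space borel (pos_sphere N))"
    by (simp add: measurable_restrict_space1)
  then have 2: "(\<lambda>u. u) \<in> borel_measurable \<nu>"
    using s measurable_cong_sets[of \<nu> "restrict_space borel (pos_sphere N)" borel borel] by simp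
  have [measurable]: "fst \<in> borel_measurable (radial_measure \<alpha> \<Otimes>\<^sub>M \<nu>)"
      "snd \<in> borel_measurable (radial_measure \<alpha> \<Otimes>\<^sub>M \<nu>)"
    using measurable_compose[OF measurable_fst 1] measurable_compose[OF measurable_snd 2] by auto
  have "(\<lambda>p. \<chi> j. fst p * (snd p $ j) powr (1 / \<alpha>)) \<in> borel_measurable (radial_measure \<alpha> \<Otimes>\<^sub>M \<nu>)"
    by (subst borel_measurable_euclidean_space) (auto simp: Basis_vec_def inner_axis)
  moreover have "polar_map \<alpha> = (\<lambda>p::real \<times> (real ^ 'n). \<chi> j. fst p * (snd p $ j) powr (1 / \<alpha>))"
    by (auto simp: fun_eq_iff polar_map_def vec_powr_def vec_eq_iff)
  ultimately have B: "polar_map \<alpha> \<in> borel_measurable (radial_measure \<alpha> \<Otimes>\<^sub>M \<nu>)" by simp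
  have "polar_map \<alpha> (r, u) \<in> E0" if "r > 0" "u \<in> pos_sphere N" for r u
  proof -
    have "u \<noteq> 0" using that assms(1) unfolding pos_sphere_def is_norm_def
      by (metis (mono_tags, lifting) mem_Collect_eq zero_neq_one)
    then obtain j where "u $ j \<noteq> 0" by (auto simp: vec_eq_iff)
    then have "polar_map \<alpha> (r, u) $ j \<noteq> 0" using that by (simp add: polar_map_def vec_powr_def)
    then have "polar_map \<alpha> (r, u) \<noteq> 0" by (metis zero_index)
    moreover have "polar_map \<alpha> (r, u) \<in> nonneg_orthant" using that
      by (simp add: nonneg_orthant_def polar_map_def vec_powr_def)
    ultimately show ?thesis
      by (simp add: E0_def)
  qed
  then show ?thesis using B
    by (intro measurable_restrict_space2)
      (auto simp: space_pair_measure sp radial_measure_def space_restrict_space)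
qed

end

theory Submission
  imports Defs
begin

text \<open>
  The exponent measure of the complement of a box is \<open>V\<^sub>i(z) = \<integral> max\<^sub>j (u\<^sup>j / (z\<^sup>j)\<^sup>\<alpha>) d\<nu>\<^sub>i(u)\<close>.
  With \<open>m = max\<^sub>j (z\<^sup>j)\<^sup>-\<^sup>\<alpha>\<close>, the moment conditions give \<open>V\<^sub>i(z) \<ge> m\<close>, while
  \<open>|V\<^sub>1(z) - V\<^sub>2(z)| \<le> m TV\<close>, where \<open>TV\<close> is the total variation distance; so the Kolmogorov distance is
  at most \<open>m exp (-m) TV \<le> TV\<close>.

  For the Wasserstein distance, split \<open>\<nu>\<^sub>i = \<nu>\<^sub>0 + \<rho>\<^sub>i\<close> with \<open>\<nu>\<^sub>0\<close> the common part, and realise \<open>Z\<^sub>i\<close> as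
  \<open>sup Z\<^sub>0 R\<^sub>i\<close> with \<open>Z\<^sub>0\<close>, \<open>R\<^sub>i\<close> independent max-stable vectors of angular measures \<open>\<nu>\<^sub>0\<close>, \<open>\<rho>\<^sub>i\<close>. If \<open>p\<close> is the
  \<open>j\<close>-th moment of \<open>\<rho>\<^sub>i\<close>, then \<open>Z\<^sub>i\<close> exceeds \<open>Z\<^sub>0\<close> in coordinate \<open>j\<close> by at most \<open>p \<Gamma>(1 - 1/\<alpha>)\<close> in
  expectation, and the two values of \<open>p\<close> add up to at most \<open>TV\<close>. To avoid constructing infinite
  Poisson processes, all vectors are first truncated from below at a level \<open>\<epsilon> > 0\<close>: the truncated vector
  is the maximum of a Poisson number of independent points, and truncation moves it by at most
  \<open>\<epsilon>\<close> per coordinate.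
\<close>

section \<open>Radial tails\<close>

lemma emeasure_radial_measure:
  assumes "A \<in> sets borel" "A \<subseteq> {0<..}"
  shows "emeasure (radial_measure \<alpha>) A = (\<integral>\<^sup>+r. ennreal (\<alpha> * r powr (- \<alpha> - 1)) * indicator A r \<partial>lborel)"
proof -
  have "A \<in> sets (restrict_space lborel {0<..})"
    using assms by (auto simp: sets_restrict_space_iff)
  then have "emeasure (radial_measure \<alpha>) A
      = (\<integral>\<^sup>+r. ennreal (\<alpha> * r powr (- \<alpha> - 1)) * indicator A r \<partial>restrict_space lborel {0<..})"
    unfolding radial_measure_def by (subst emeasure_density) (auto intro!: measurable_restrict_space1)
  also have "\<dots> = (\<integral>\<^sup>+r. ennreal (\<alpha> * r powr (- \<alpha> - 1)) * indicator A r * indicator {0<..} r \<partial>lborel)"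
    by (subst nn_integral_restrict_space) auto
  also have "\<dots> = (\<integral>\<^sup>+r. ennreal (\<alpha> * r powr (- \<alpha> - 1)) * indicator A r \<partial>lborel)"
    using assms(2) by (intro nn_integral_cong) (auto simp: indicator_def)
  finally show ?thesis .
qed

text \<open>The density has the antiderivative \<open>- (r powr - \<alpha>)\<close>, which vanishes
  at infinity.\<close>

lemma emeasure_radial_measure_greaterThan:
  assumes "\<alpha> > 0" "t > 0"
  shows "emeasure (radial_measure \<alpha>) {t<..} = ennreal (t powr (- \<alpha>))"
proof -
  have "emeasure (radial_measure \<alpha>) {t<..}
      = (\<integral>\<^sup>+r. ennreal (\<alpha> * r powr (- \<alpha> - 1)) * indicator {t<..} r \<partial>lborel)"
    using assms by (intro emeasure_radial_measure) auto
  also have "\<dots> = (\<integral>\<^sup>+r. ennreal (\<alpha> * r powr (- \<alpha> - 1)) * indicator {t..} r \<partial>lborel)"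
    by (intro nn_integral_cong_AE AE_I[where N="{t}"]) (auto simp: indicator_def)
  also have "\<dots> = ennreal (0 - (- (t powr (- \<alpha>))))"
  proof (rule nn_integral_FTC_atLeast)
    show "((\<lambda>r. - (r powr - \<alpha>)) has_real_derivative \<alpha> * x powr (- \<alpha> - 1)) (at x)" if "t \<le> x" for x
      using that assms by (auto intro!: derivative_eq_intros simp: powr_diff)
    show "((\<lambda>r. - (r powr - \<alpha>)) \<longlongrightarrow> 0) at_top"
      using tendsto_minus[OF tendsto_neg_powr[of "-\<alpha>" "\<lambda>x. x" at_top]] assms by (simp add: filterlim_ident)
  qed (use assms in auto)
  finally show ?thesis by simp
qed

lemma sets_radial_measure: "sets (radial_measure \<alpha>) = sets (restrict_space borel {0<..})"
  by (simp add: radial_measure_def sets_restrict_space)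

lemma space_radial_measure: "space (radial_measure \<alpha>) = {0<..}"
  by (simp add: radial_measure_def space_restrict_space)

text \<open>The mass near 0 is infinite, so the cover consists of half-lines starting at
  \<open>1 / real (Suc n)\<close>. Sigma-finiteness opens products with measures of directions to
  Tonelli.\<close>

lemma sigma_finite_radial_measure:
  assumes "\<alpha> > 0"
  shows "sigma_finite_measure (radial_measure \<alpha>)"
proof
  let ?F = "range (\<lambda>n. {1 / real (Suc n)<..})"
  have "\<Union>?F = {0<..}"
  proof safe
    fix x :: real assume "0 < x"
    then obtain n where "1 / real (Suc n) < x" using nat_approx_posE by metis
    then show "x \<in> \<Union>?F" by auto
  next
    fix x :: real and n assume "1 / real (Suc n) < x"
    moreover have "0 < 1 / real (Suc n)" by simp
    ultimately show "0 < x" by linarith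
  qed
  moreover have "{1 / real (Suc n)<..} \<in> sets (radial_measure \<alpha>)" for n
    unfolding sets_radial_measure by (subst sets_restrict_space_iff) (auto intro: less_trans[rotated])
  moreover have "emeasure (radial_measure \<alpha>) {1 / real (Suc n)<..} \<noteq> \<infinity>" for n
    using assms by (subst emeasure_radial_measure_greaterThan) auto
  ultimately show "\<exists>A. countable A \<and> A \<subseteq> sets (radial_measure \<alpha>) \<and> \<Union>A = space (radial_measure \<alpha>) \<and>
      (\<forall>a\<in>A. emeasure (radial_measure \<alpha>) a \<noteq> \<infinity>)"
    by (intro exI[of _ ?F]) (auto simp: space_radial_measure)
qed

text \<open>The condition reads \<open>r > t / v powr (1 / \<alpha>)\<close>, and the tail exponent
  \<open>- \<alpha>\<close> undoes the power \<open>1 / \<alpha>\<close> built into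
  \<open>polar_map\<close>. Hence the mass is linear in \<open>v\<close>, which is what lets the
  moments of an angular measure govern the marginals.\<close>

lemma emeasure_radial_measure_scaled:
  assumes "\<alpha> > 0" "t > 0" "0 \<le> v"
  shows "emeasure (radial_measure \<alpha>) {r. 0 < r \<and> t < r * v powr (1 / \<alpha>)} = ennreal (v * t powr (- \<alpha>))"
proof (cases "v = 0")
  case False
  with assms have v: "v > 0" by simp
  have "{r. 0 < r \<and> t < r * v powr (1 / \<alpha>)} = {t / v powr (1 / \<alpha>)<..}"
    using v assms by (auto simp: field_simps intro: less_trans[rotated])
  then show ?thesis using v assms
    by (simp add: emeasure_radial_measure_greaterThan powr_divide powr_powr powr_minus field_simps)
qed (use assms in auto)

text \<open>The left side is the mean of a unit Frechet variable, as the integral of its tail.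
  Writing the tail as an integral of \<open>exp (- x)\<close> and exchanging the order of
  integration yields Euler's integral.\<close>

lemma nn_integral_lborel_Ioi_one_minus_exp:
  assumes "\<alpha> > 1"
  shows "(\<integral>\<^sup>+t. ennreal (1 - exp (- (t powr (- \<alpha>)))) * indicator {0<..} t \<partial>lborel)
    = ennreal (Gamma (1 - 1 / \<alpha>))"
proof -
  \<comment> \<open>The region is \<open>0 < x < t powr (- \<alpha>)\<close>: integrating over
    \<open>x\<close> gives the Frechet tail, integrating over \<open>t\<close> gives the length
    \<open>x powr (- 1 / \<alpha>)\<close>.\<close>
  define f where "f t x = ennreal (exp (- x)) * indicator {p. 0 < fst p \<and> 0 < snd p \<and> snd p < fst p powr (- \<alpha>)} (t, x)"
    for t x :: real
  have f_meas: "case_prod f \<in> borel_measurable (lborel \<Otimes>\<^sub>M lborel)"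
    unfolding f_def case_prod_beta' by measurable
  have "(\<integral>\<^sup>+x. f t x \<partial>lborel) = ennreal (1 - exp (- (t powr (- \<alpha>)))) * indicator {0<..} t" for t
  proof (cases "t > 0")
    case True
    then have "(\<integral>\<^sup>+x. f t x \<partial>lborel) = (\<integral>\<^sup>+x. ennreal (exp (- x)) * indicator {0..t powr (- \<alpha>)} x \<partial>lborel)"
      by (intro nn_integral_cong_AE AE_I[where N="{0, t powr (- \<alpha>)}"])
        (auto simp: f_def indicator_def emeasure_lborel_countable)
    also have "\<dots> = ennreal (- exp (- (t powr (- \<alpha>))) - (- exp (- 0)))"
      by (intro nn_integral_FTC_Icc) (auto intro!: derivative_eq_intros)
    finally show ?thesis using True by simp
  qed (simp add: f_def)
  then have "(\<integral>\<^sup>+t. ennreal (1 - exp (- (t powr (- \<alpha>)))) * indicator {0<..} t \<partial>lborel)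
      = (\<integral>\<^sup>+t. \<integral>\<^sup>+x. f t x \<partial>lborel \<partial>lborel)" by simp
  also have "\<dots> = (\<integral>\<^sup>+x. \<integral>\<^sup>+t. f t x \<partial>lborel \<partial>lborel)"
    using f_meas by (rule lborel_pair.Fubini'[symmetric])
  also have "\<dots> = (\<integral>\<^sup>+x. ennreal (indicator {0..} x * x powr ((1 - 1 / \<alpha>) - 1) / exp x) \<partial>lborel)"
  proof (intro nn_integral_cong_AE AE_I[where N="{0}"])
    show "{x \<in> space lborel. (\<integral>\<^sup>+t. f t x \<partial>lborel) \<noteq> ennreal (indicator {0..} x * x powr ((1 - 1 / \<alpha>) - 1) / exp x)} \<subseteq> {0}"
    proof (safe, rule ccontr)
      fix x :: real
      assume ne: "(\<integral>\<^sup>+t. f t x \<partial>lborel) \<noteq> ennreal (indicator {0..} x * x powr ((1 - 1 / \<alpha>) - 1) / exp x)" and "x \<noteq> 0"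
      show False
      proof (cases "x > 0")
        case True
        have "0 < t \<and> x < t powr (- \<alpha>) \<longleftrightarrow> t \<in> {0<..<x powr (- 1 / \<alpha>)}" for t
        proof -
          have "x < t powr (- \<alpha>) \<longleftrightarrow> t < x powr (- 1 / \<alpha>)" if "t > 0"
          proof -
            have "x < t powr (- \<alpha>) \<longleftrightarrow> (t powr (- \<alpha>)) powr (- 1 / \<alpha>) < x powr (- 1 / \<alpha>)"
            proof
              show "(t powr (- \<alpha>)) powr (- 1 / \<alpha>) < x powr (- 1 / \<alpha>)" if "x < t powr (- \<alpha>)"
                using that True assms by (intro powr_less_mono2_neg) auto
              show "x < t powr (- \<alpha>)" if "(t powr (- \<alpha>)) powr (- 1 / \<alpha>) < x powr (- 1 / \<alpha>)"
                using that powr_mono2'[of "- 1 / \<alpha>" "t powr (- \<alpha>)" x] \<open>t > 0\<close> assms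
                by (force simp: not_less)
            qed
            then show ?thesis using that assms by (simp add: powr_powr)
          qed
          then show ?thesis by auto
        qed
        then have "(\<integral>\<^sup>+t. f t x \<partial>lborel) = (\<integral>\<^sup>+t. ennreal (exp (- x)) * indicator {0<..<x powr (- 1 / \<alpha>)} t \<partial>lborel)"
          using True by (intro nn_integral_cong) (simp add: f_def indicator_def)
        also have "\<dots> = ennreal (x powr ((1 - 1 / \<alpha>) - 1) / exp x)"
          using True by (simp add: nn_integral_cmult exp_minus field_simps flip: ennreal_mult')
        finally show False using ne True by simp
      qed (use ne \<open>x \<noteq> 0\<close> in \<open>simp add: f_def\<close>)
    qed
  qed auto
  also have "\<dots> = ennreal (Gamma (1 - 1 / \<alpha>))"
    using assms by (intro Gamma_conv_nn_integral_real[symmetric]) simp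
  finally show ?thesis .
qed

section \<open>Maxima of Poisson samples\<close>

text \<open>An equivalence, not only closure under \<open>sup\<close>: on vectors the set is also
  downward closed. Thus a maximum lies in \<open>A\<close> exactly when every point does, and
  probabilities of maxima of independent points factorise.\<close>

definition sup_closed :: "'a::sup set \<Rightarrow> bool" where
  "sup_closed A \<longleftrightarrow> (\<forall>x y. sup x y \<in> A \<longleftrightarrow> x \<in> A \<and> y \<in> A)"

definition sup_convolution :: "'a::{sup, topological_space} measure \<Rightarrow> 'a measure \<Rightarrow> 'a measure" where
  "sup_convolution P Q = distr (P \<Otimes>\<^sub>M Q) borel (\<lambda>(x, y). sup x y)"

lemma borel_measurable_sup_vec [measurable]:
  "(\<lambda>p. sup (fst p) (snd p)) \<in> borel_measurable (borel \<Otimes>\<^sub>M (borel :: (real ^ 'n::finite) measure))"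
proof -
  have "continuous_on UNIV (\<lambda>p::(real ^ 'n) \<times> (real ^ 'n). sup (fst p) (snd p))"
    unfolding continuous_on_def by (intro ballI tendsto_sup tendsto_fst tendsto_snd tendsto_ident_at)
  then show ?thesis
    unfolding borel_prod by (rule borel_measurable_continuous_onI)
qed

lemma measurable_sup_pair:
  fixes P Q :: "(real ^ 'n::finite) measure"
  assumes "sets P = sets borel" "sets Q = sets borel"
  shows "(\<lambda>(x, y). sup x y) \<in> borel_measurable (P \<Otimes>\<^sub>M Q)"
  using borel_measurable_sup_vec
  unfolding measurable_cong_sets[OF sets_pair_measure_cong[OF assms] refl] case_prod_beta' .

lemma sets_sup_convolution [simp]: "sets (sup_convolution P Q) = sets borel"
  by (simp add: sup_convolution_def)

lemma prob_space_sup_convolution: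
  fixes P Q :: "(real ^ 'n::finite) measure"
  assumes "prob_space P" "prob_space Q" "sets P = sets borel" "sets Q = sets borel"
  shows "prob_space (sup_convolution P Q)"
proof -
  interpret pair_prob_space P Q
    using assms by (simp add: pair_prob_space_def pair_sigma_finite_def prob_space_imp_sigma_finite)
  show ?thesis unfolding sup_convolution_def
    by (rule prob_space_distr) (rule measurable_sup_pair[OF assms(3,4)])
qed

text \<open>For a \<open>sup_closed\<close> set the preimage of \<open>A\<close> under the maximum
  is the rectangle \<open>A \<times> A\<close>.\<close>

lemma emeasure_sup_convolution:
  fixes P Q :: "(real ^ 'n::finite) measure"
  assumes "prob_space P" "prob_space Q" "sets P = sets borel" "sets Q = sets borel"
    and "A \<in> sets borel" "sup_closed A"
  shows "emeasure (sup_convolution P Q) A = emeasure P A * emeasure Q A"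
proof -
  interpret P: prob_space P by fact
  interpret Q: prob_space Q by fact
  have "(\<lambda>(x, y). sup x y) -` A \<inter> space (P \<Otimes>\<^sub>M Q) = A \<times> A"
    using assms sets_eq_imp_space_eq[OF assms(3)] sets_eq_imp_space_eq[OF assms(4)]
    by (auto simp: space_pair_measure sup_closed_def)
  then show ?thesis unfolding sup_convolution_def
    using assms by (subst emeasure_distr[OF measurable_sup_pair[OF assms(3,4)]])
      (auto simp: Q.emeasure_pair_measure_Times)
qed

text \<open>The witness is the law of the maximum of \<open>e\<close> and \<open>k\<close>
  independent points with law \<open>L\<close>. Starting from the constant \<open>e\<close> gives a
  meaning to the empty sample and accounts for the indicator.\<close>

lemma sup_convolution_power_exists:
  fixes L :: "(real ^ 'n::finite) measure"
  assumes "prob_space L" "sets L = sets borel"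
  shows "\<exists>Q. prob_space Q \<and> sets Q = sets borel \<and>
    (\<forall>A\<in>sets borel. sup_closed A \<longrightarrow> emeasure Q A = indicator A e * emeasure L A ^ k)"
proof (induction k)
  case 0
  show ?case
    by (intro exI[of _ "return borel e"]) (simp add: prob_space_return)
next
  case (Suc k)
  then obtain Q where Q: "prob_space Q" "sets Q = sets borel"
    "\<And>A. A \<in> sets borel \<Longrightarrow> sup_closed A \<Longrightarrow> emeasure Q A = indicator A e * emeasure L A ^ k"
    by blast
  have "emeasure (sup_convolution L Q) A = indicator A e * emeasure L A ^ Suc k"
    if "A \<in> sets borel" "sup_closed A" for A
    using that Q assms by (simp add: emeasure_sup_convolution mult_ac)
  then show ?case using Q assms
    by (intro exI[of _ "sup_convolution L Q"])
      (auto simp: prob_space_sup_convolution)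
qed

text \<open>The sample size is mixed over a Poisson law. With \<open>q = measure L A\<close>, a
  sample of size \<open>k\<close> contributes \<open>q ^ k\<close>, and the Poisson generating
  function at \<open>q\<close> is \<open>exp (- (rate * (1 - q)))\<close>.\<close>

lemma compound_poisson_sup_exists_positive:
  fixes L :: "(real ^ 'n::finite) measure"
  assumes "prob_space L" "sets L = sets borel" "0 < rate"
  shows "\<exists>P. prob_space P \<and> sets P = sets borel \<and>
    (\<forall>A\<in>sets borel. sup_closed A \<longrightarrow>
       emeasure P A = indicator A e * ennreal (exp (- (rate * (1 - measure L A)))))"
proof -
  interpret L: prob_space L by fact
  obtain Q where Q: "\<And>k::nat. prob_space (Q k)" "\<And>k. sets (Q k) = sets borel"
    "\<And>k A. A \<in> sets borel \<Longrightarrow> sup_closed A \<Longrightarrow> emeasure (Q k) A = indicator A e * emeasure L A ^ k"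
    using sup_convolution_power_exists[OF assms(1,2), of e] by metis
  have QM: "Q \<in> measurable (measure_pmf (poisson_pmf rate)) (subprob_algebra borel)"
    using Q(1,2) by (auto simp: space_subprob_algebra prob_space_imp_subprob_space)
  define P where "P = measure_pmf (poisson_pmf rate) \<bind> Q"
  have "prob_space P"
    unfolding P_def using QM Q(1) by (intro measure_pmf.prob_space_bind[where S=borel]) auto
  moreover have "sets P = sets borel"
    unfolding P_def by (rule sets_bind) (use Q(2) in auto)
  moreover have "emeasure P A = indicator A e * ennreal (exp (- (rate * (1 - measure L A))))"
    if A: "A \<in> sets borel" "sup_closed A" for A
  proof -
    define q where "q = measure L A"
    have q: "0 \<le> q" "emeasure L A = ennreal q" by (auto simp: q_def L.emeasure_eq_measure)
    have "emeasure P A = (\<integral>\<^sup>+k. emeasure (Q k) A \<partial>measure_pmf (poisson_pmf rate))"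
      unfolding P_def using QM A by (intro emeasure_bind[where N=borel]) auto
    also have "\<dots> = (\<integral>\<^sup>+k. indicator A e * ennreal (q ^ k) \<partial>measure_pmf (poisson_pmf rate))"
      using Q(3)[OF A] q by (simp add: ennreal_power)
    also have "\<dots> = indicator A e * (\<integral>\<^sup>+k. ennreal (q ^ k) \<partial>measure_pmf (poisson_pmf rate))"
      by (subst nn_integral_cmult) auto
    also have "(\<integral>\<^sup>+k. ennreal (q ^ k) \<partial>measure_pmf (poisson_pmf rate))
        = (\<Sum>k. ennreal (exp (- rate) * ((rate * q) ^ k /\<^sub>R fact k)))"
    proof -
      have "ennreal (pmf (poisson_pmf rate) k) * ennreal (q ^ k)
          = ennreal (exp (- rate) * ((rate * q) ^ k /\<^sub>R fact k))" for k
      proof -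
        have "ennreal (pmf (poisson_pmf rate) k) * ennreal (q ^ k)
            = ennreal (pmf (poisson_pmf rate) k * q ^ k)"
          using q(1) by (simp add: ennreal_mult)
        also have "pmf (poisson_pmf rate) k * q ^ k = exp (- rate) * ((rate * q) ^ k /\<^sub>R fact k)"
          using assms(3) by (simp add: power_mult_distrib divide_inverse mult_ac)
        finally show ?thesis .
      qed
      then show ?thesis
        by (simp only: nn_integral_measure_pmf nn_integral_count_space_nat)
    qed
    also have "\<dots> = ennreal (exp (- rate) * exp (rate * q))"
      using assms(3) q(1) by (intro suminf_ennreal_eq sums_mult exp_converges) auto
    also have "\<dots> = ennreal (exp (- (rate * (1 - q))))"
      by (simp add: right_diff_distrib flip: exp_add)
    finally show ?thesis by (simp add: q_def)
  qed
  ultimately show ?thesis by blast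
qed

text \<open>The exponential is the probability that a Poisson process of intensity \<open>m\<close>
  has no point outside \<open>A\<close>. Normalising \<open>m\<close> and using its mass as the rate
  reduces this to a Poisson sample; the zero measure cannot be normalised and corresponds to an
  empty sample.\<close>

lemma compound_poisson_sup_exists:
  fixes m :: "(real ^ 'n::finite) measure"
  assumes "finite_measure m" "sets m = sets borel"
  shows "\<exists>P. prob_space P \<and> sets P = sets borel \<and>
    (\<forall>A\<in>sets borel. sup_closed A \<longrightarrow>
       emeasure P A = indicator A e * ennreal (exp (- measure m (- A))))"
proof (cases "measure m UNIV = 0")
  case True
  interpret finite_measure m by fact
  have sp: "space m = UNIV" using sets_eq_imp_space_eq[OF assms(2)] by simp
  have "measure m (- A) = 0" for A
    using True bounded_measure[of "- A"] sp by (simp add: measure_le_0_iff)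
  then show ?thesis
    by (intro exI[of _ "return borel e"]) (simp add: prob_space_return)
next
  case False
  interpret finite_measure m by fact
  have sp: "space m = UNIV" using sets_eq_imp_space_eq[OF assms(2)] by simp
  define c where "c = measure m UNIV"
  have c: "c > 0" using False by (simp add: c_def zero_less_measure_iff)
  define L where "L = scale_measure (ennreal (1 / c)) m"
  have L: "sets L = sets borel" "emeasure L A = ennreal (1 / c) * emeasure m A" for A
    using assms by (auto simp: L_def)
  have L_space: "space L = UNIV" using sets_eq_imp_space_eq[OF L(1)] by simp
  have "prob_space L"
    using c by (intro prob_spaceI)
      (simp add: L(2) space_scale_measure sp emeasure_eq_measure L_space flip: ennreal_mult' c_def)
  then obtain P where P: "prob_space P" "sets P = sets borel"
    "\<And>A. A \<in> sets borel \<Longrightarrow> sup_closed A \<Longrightarrow>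
       emeasure P A = indicator A e * ennreal (exp (- (c * (1 - measure L A))))"
    using compound_poisson_sup_exists_positive[of L c e] c L(1) by blast
  have "c * (1 - measure L A) = measure m (- A)" if "A \<in> sets borel" for A
  proof -
    have "measure L A = measure m A / c"
      using c by (simp add: measure_def[of L] L emeasure_eq_measure flip: ennreal_mult')
    moreover have "measure m (- A) = c - measure m A"
      using finite_measure_compl[of A] that assms sp by (simp add: c_def Compl_eq_Diff_UNIV)
    ultimately show ?thesis using c by (simp add: field_simps)
  qed
  then show ?thesis using P by (intro exI[of _ P]) auto
qed

section \<open>Exceedances and truncated max-stable laws\<close>

text \<open>Integrated over directions \<open>u\<close>, this is the mass that the exponent measure,
  restricted to radii above \<epsilon>, gives to the complement of \<open>A\<close>. The cut at
  \<epsilon> > 0 keeps it finite.\<close>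

definition exceedance :: "real \<Rightarrow> real \<Rightarrow> (real ^ 'n) set \<Rightarrow> real ^ 'n \<Rightarrow> ennreal" where
  "exceedance \<alpha> \<epsilon> A u = emeasure (radial_measure \<alpha>) {r. \<epsilon> < r \<and> polar_map \<alpha> (r, u) \<notin> A}"

text \<open>For directions in the unit cube this describes the maximum of the constant vector
  \<epsilon> and a Poisson process with the exponent measure as intensity: points of radius at most
  \<epsilon> lie below that vector and are dropped. The law is prescribed on all
  \<open>sup_closed\<close> sets because orthants identify it and half-spaces carry its
  marginals.\<close>

definition max_stable_truncation ::
    "real \<Rightarrow> real \<Rightarrow> (real ^ 'n::finite) measure \<Rightarrow> (real ^ 'n) measure \<Rightarrow> bool" where
  "max_stable_truncation \<alpha> \<epsilon> \<rho> P \<longleftrightarrow> prob_space P \<and> sets P = sets borel \<and>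
    (\<forall>A\<in>sets borel. sup_closed A \<longrightarrow>
       emeasure P A = indicator A (\<chi> j. \<epsilon>) * ennreal (exp (- enn2real (\<integral>\<^sup>+u. exceedance \<alpha> \<epsilon> A u \<partial>\<rho>))))"

text \<open>A common setting for angular measures and for the pieces into which they are split;
  hence no moment condition is imposed.\<close>

locale cube_measure = finite_measure \<rho> for \<rho> :: "(real ^ 'n::finite) measure" +
  fixes \<alpha> :: real
  assumes ident_measurable: "(\<lambda>u. u) \<in> borel_measurable \<rho>"
    and space_subset_cube: "space \<rho> \<subseteq> {0..1}"
    and alpha_pos: "0 < \<alpha>"
begin

sublocale polar: pair_sigma_finite "radial_measure \<alpha>" \<rho>
  using sigma_finite_radial_measure[OF alpha_pos] sigma_finite_measure_axioms
  by (simp add: pair_sigma_finite_def)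

lemma component_bounds: "u \<in> space \<rho> \<Longrightarrow> 0 \<le> u $ j \<and> u $ j \<le> 1"
  using space_subset_cube by (auto simp: less_eq_vec_def)

lemma component_measurable: "(\<lambda>u. u $ j) \<in> borel_measurable \<rho>"
  using measurable_compose[OF ident_measurable, of "\<lambda>u. u $ j" borel] by simp

lemma integrable_component: "integrable \<rho> (\<lambda>u. u $ j)"
  using component_bounds by (intro integrable_const_bound[where B=1]) (auto intro!: AE_I2 component_measurable simp: abs_le_iff)

lemma radial_measurable: "(\<lambda>r. r) \<in> borel_measurable (radial_measure \<alpha>)"
  by (simp add: radial_measure_def measurable_restrict_space1)

lemma polar_map_measurable: "polar_map \<alpha> \<in> borel_measurable (radial_measure \<alpha> \<Otimes>\<^sub>M \<rho>)"
proof -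
  have [measurable]: "fst \<in> borel_measurable (radial_measure \<alpha> \<Otimes>\<^sub>M \<rho>)"
      "snd \<in> borel_measurable (radial_measure \<alpha> \<Otimes>\<^sub>M \<rho>)"
    using measurable_compose[OF measurable_fst radial_measurable]
      measurable_compose[OF measurable_snd ident_measurable] by auto
  have "(\<lambda>p. \<chi> j. fst p * (snd p $ j) powr (1 / \<alpha>)) \<in> borel_measurable (radial_measure \<alpha> \<Otimes>\<^sub>M \<rho>)"
    by (subst borel_measurable_euclidean_space) (auto simp: Basis_vec_def inner_axis)
  moreover have "polar_map \<alpha> = (\<lambda>p::real \<times> (real ^ 'n). \<chi> j. fst p * (snd p $ j) powr (1 / \<alpha>))"
    by (auto simp: fun_eq_iff polar_map_def vec_powr_def vec_eq_iff)
  ultimately show ?thesis by simp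
qed

definition exceedance_set :: "real \<Rightarrow> (real ^ 'n) set \<Rightarrow> (real \<times> (real ^ 'n)) set" where
  "exceedance_set \<epsilon> A = {p \<in> space (radial_measure \<alpha> \<Otimes>\<^sub>M \<rho>). \<epsilon> < fst p \<and> polar_map \<alpha> p \<notin> A}"

lemma exceedance_set_measurable:
  assumes "A \<in> sets borel"
  shows "exceedance_set \<epsilon> A \<in> sets (radial_measure \<alpha> \<Otimes>\<^sub>M \<rho>)"
proof -
  have [measurable]: "fst \<in> borel_measurable (radial_measure \<alpha> \<Otimes>\<^sub>M \<rho>)"
    using measurable_compose[OF measurable_fst radial_measurable] by auto
  note polar_map_measurable [measurable] assms [measurable]
  show ?thesis unfolding exceedance_set_def by measurable
qed

text \<open>Presents the exceedance as the mass of a section of a product set, which gives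
  measurability in \<open>u\<close> and Tonelli. Positivity of \<epsilon> ensures that every
  \<open>r > \<epsilon>\<close> lies in the space of the radial measure.\<close>

lemma exceedance_eq:
  assumes "0 < \<epsilon>" "u \<in> space \<rho>"
  shows "exceedance \<alpha> \<epsilon> A u = emeasure (radial_measure \<alpha>) ((\<lambda>r. (r, u)) -` exceedance_set \<epsilon> A)"
proof -
  have "(\<lambda>r. (r, u)) -` exceedance_set \<epsilon> A = {r. \<epsilon> < r \<and> polar_map \<alpha> (r, u) \<notin> A}"
    using assms by (auto simp: exceedance_set_def space_pair_measure space_radial_measure)
  then show ?thesis by (simp add: exceedance_def)
qed

lemma exceedance_measurable:
  assumes "0 < \<epsilon>" "A \<in> sets borel"
  shows "exceedance \<alpha> \<epsilon> A \<in> borel_measurable \<rho>"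
proof -
  have "(\<lambda>u. emeasure (radial_measure \<alpha>) ((\<lambda>r. (r, u)) -` exceedance_set \<epsilon> A)) \<in> borel_measurable \<rho>"
    by (rule polar.measurable_emeasure_Pair2[OF exceedance_set_measurable[OF assms(2)]])
  then show ?thesis
    by (simp add: measurable_cong[OF exceedance_eq[OF assms(1)]])
qed

lemma emeasure_exceedance_set:
  assumes "0 < \<epsilon>" "A \<in> sets borel"
  shows "emeasure (radial_measure \<alpha> \<Otimes>\<^sub>M \<rho>) (exceedance_set \<epsilon> A) = (\<integral>\<^sup>+u. exceedance \<alpha> \<epsilon> A u \<partial>\<rho>)"
  using polar.emeasure_pair_measure_alt2[OF exceedance_set_measurable[OF assms(2), of \<epsilon>]]
  by (auto simp: exceedance_eq assms(1) intro!: nn_integral_cong)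

lemma exceedance_le:
  assumes "0 < \<epsilon>"
  shows "exceedance \<alpha> \<epsilon> A u \<le> ennreal (\<epsilon> powr (- \<alpha>))"
proof -
  have "{\<epsilon><..} \<in> sets (radial_measure \<alpha>)"
    unfolding sets_radial_measure using assms by (subst sets_restrict_space_iff) auto
  then have "exceedance \<alpha> \<epsilon> A u \<le> emeasure (radial_measure \<alpha>) {\<epsilon><..}"
    unfolding exceedance_def by (intro emeasure_mono) auto
  also have "\<dots> = ennreal (\<epsilon> powr (- \<alpha>))"
    using assms alpha_pos by (rule emeasure_radial_measure_greaterThan[rotated])
  finally show ?thesis .
qed

lemma nn_integral_exceedance_finite:
  assumes "0 < \<epsilon>"
  shows "(\<integral>\<^sup>+u. exceedance \<alpha> \<epsilon> A u \<partial>\<rho>) < \<infinity>"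
proof -
  have "(\<integral>\<^sup>+u. exceedance \<alpha> \<epsilon> A u \<partial>\<rho>) \<le> (\<integral>\<^sup>+u. ennreal (\<epsilon> powr (- \<alpha>)) \<partial>\<rho>)"
    using assms by (intro nn_integral_mono exceedance_le)
  also have "\<dots> < \<infinity>"
    by (simp add: emeasure_eq_measure flip: ennreal_mult')
  finally show ?thesis .
qed

text \<open>At levels \<open>t \<ge> \<epsilon>\<close> the cut is invisible: since
  \<open>u $ j \<le> 1\<close>, a point whose coordinate exceeds \<open>t\<close> already has radius
  above \<epsilon>.\<close>

lemma exceedance_halfspace:
  assumes "0 < \<epsilon>" "\<epsilon> \<le> t" "u \<in> space \<rho>"
  shows "exceedance \<alpha> \<epsilon> {x. x $ j \<le> t} u = ennreal (u $ j * t powr (- \<alpha>))"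
proof -
  have u: "0 \<le> u $ j" "u $ j \<le> 1" using component_bounds[OF assms(3)] by auto
  have "{r. \<epsilon> < r \<and> polar_map \<alpha> (r, u) \<notin> {x. x $ j \<le> t}} = {r. 0 < r \<and> t < r * (u $ j) powr (1 / \<alpha>)}"
  proof -
    have "\<epsilon> < r" if "0 < r" "t < r * (u $ j) powr (1 / \<alpha>)" for r
    proof -
      have "r * (u $ j) powr (1 / \<alpha>) \<le> r * 1"
        using u that alpha_pos by (intro mult_left_mono powr_le1) auto
      then show ?thesis using that assms by linarith
    qed
    then show ?thesis using assms by (auto simp: polar_map_def vec_powr_def)
  qed
  then show ?thesis
    using emeasure_radial_measure_scaled[of \<alpha> t "u $ j"] alpha_pos assms u by (simp add: exceedance_def)
qed

lemma nn_integral_exceedance_halfspace: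
  assumes "0 < \<epsilon>" "\<epsilon> \<le> t"
  shows "(\<integral>\<^sup>+u. exceedance \<alpha> \<epsilon> {x. x $ j \<le> t} u \<partial>\<rho>) = ennreal ((\<integral>u. u $ j \<partial>\<rho>) * t powr (- \<alpha>))"
proof -
  have "(\<integral>\<^sup>+u. exceedance \<alpha> \<epsilon> {x. x $ j \<le> t} u \<partial>\<rho>) = (\<integral>\<^sup>+u. ennreal (u $ j * t powr (- \<alpha>)) \<partial>\<rho>)"
    using assms by (intro nn_integral_cong exceedance_halfspace)
  also have "\<dots> = ennreal (\<integral>u. u $ j * t powr (- \<alpha>) \<partial>\<rho>)"
    using component_bounds integrable_component by (intro nn_integral_eq_integral) (auto intro!: AE_I2)
  finally show ?thesis by simp
qed

text \<open>The exponent measure of \<rho> restricted to radii above \<epsilon> is finite, so it can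
  serve as the intensity of a Poisson sample, with the maximum started at the constant vector
  \<epsilon>.\<close>

lemma max_stable_truncation_exists:
  assumes "0 < \<epsilon>"
  shows "\<exists>P. max_stable_truncation \<alpha> \<epsilon> \<rho> P"
proof -
  \<comment> \<open>With the empty set as \<open>A\<close>, every point of radius above \<epsilon>
    counts as an exceedance.\<close>
  define R where "R = restrict_space (radial_measure \<alpha> \<Otimes>\<^sub>M \<rho>) (exceedance_set \<epsilon> {})"
  define m where "m = distr R borel (polar_map \<alpha>)"
  have E: "exceedance_set \<epsilon> {} \<in> sets (radial_measure \<alpha> \<Otimes>\<^sub>M \<rho>)"
    by (rule exceedance_set_measurable) simp
  have pm: "polar_map \<alpha> \<in> borel_measurable R"
    unfolding R_def using polar_map_measurable by (rule measurable_restrict_space1)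
  have em: "emeasure m (- A) = (\<integral>\<^sup>+u. exceedance \<alpha> \<epsilon> A u \<partial>\<rho>)" if A: "A \<in> sets borel" for A
  proof -
    have "polar_map \<alpha> -` (- A) \<inter> space R = exceedance_set \<epsilon> A"
      by (auto simp: R_def space_restrict_space exceedance_set_def)
    then have "emeasure m (- A) = emeasure R (exceedance_set \<epsilon> A)"
      using A pm by (simp add: m_def emeasure_distr)
    also have "\<dots> = emeasure (radial_measure \<alpha> \<Otimes>\<^sub>M \<rho>) (exceedance_set \<epsilon> A)"
      unfolding R_def using E by (intro emeasure_restrict_space) (auto simp: exceedance_set_def)
    finally show ?thesis using assms A by (simp add: emeasure_exceedance_set)
  qed
  have "finite_measure m"
    using em[of "{}"] nn_integral_exceedance_finite[OF assms, of "{}"]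
    by (intro finite_measureI) (simp add: m_def less_top)
  moreover have "sets m = sets borel" by (simp add: m_def)
  ultimately obtain P where P: "prob_space P" "sets P = sets borel"
    "\<And>A. A \<in> sets borel \<Longrightarrow> sup_closed A \<Longrightarrow>
       emeasure P A = indicator A (\<chi> j. \<epsilon>) * ennreal (exp (- measure m (- A)))"
    using compound_poisson_sup_exists[of m "\<chi> j. \<epsilon>"] by blast
  then show ?thesis unfolding max_stable_truncation_def
    using em by (intro exI[of _ P]) (simp add: measure_def)
qed

end

section \<open>The exponent measure of the complement of a box\<close>

lemma sup_closed_atMost: "sup_closed {..z :: 'a::semilattice_sup}"
  by (simp add: sup_closed_def)

lemma sup_closed_halfspace: "sup_closed {x :: real ^ 'n. x $ j \<le> t}"
  by (simp add: sup_closed_def sup_vec_def)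

lemma sets_angular_measure:
  "angular_measure N \<nu> \<Longrightarrow> sets \<nu> = sets (restrict_space borel (pos_sphere N))"
  by (simp add: angular_measure_def)

lemma space_angular_measure: "angular_measure N \<nu> \<Longrightarrow> space \<nu> = pos_sphere N"
  using sets_eq_imp_space_eq[OF sets_angular_measure] by (simp add: space_restrict_space)

lemma cube_measureI:
  assumes "finite_measure \<rho>" "sets \<rho> = sets (restrict_space borel B)" "B \<subseteq> {0..1}" "0 < \<alpha>"
  shows "cube_measure \<rho> \<alpha>"
proof -
  have "(\<lambda>u. u) \<in> borel_measurable (restrict_space borel B)"
    by (simp add: measurable_restrict_space1)
  then have "(\<lambda>u. u) \<in> borel_measurable \<rho>"
    using measurable_cong_sets[OF assms(2) refl] by blast
  moreover have "space \<rho> = B"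
    using sets_eq_imp_space_eq[OF assms(2)] by (simp add: space_restrict_space)
  ultimately show ?thesis
    using assms by (simp add: cube_measure_def cube_measure_axioms_def)
qed

text \<open>Cutting at a radius \<epsilon> below all coordinates of \<open>z\<close> loses nothing,
  because a point of radius at most \<epsilon> with direction in the unit cube stays inside the box.
  This links the defining exponent to exceedances.\<close>

lemma measure_exponent_measure_compl_box:
  fixes N :: "real ^ 'n::finite \<Rightarrow> real"
  assumes "is_norm N" "pos_sphere N \<subseteq> {0..1}" "\<alpha> > 0" "angular_measure N \<nu>"
    and "0 < \<epsilon>" "\<And>j. \<epsilon> \<le> z $ j"
  shows "measure (exponent_measure \<alpha> \<nu>) (E0 - {0..z}) = enn2real (\<integral>\<^sup>+u. exceedance \<alpha> \<epsilon> {..z} u \<partial>\<nu>)"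
proof -
  have fin: "finite_measure \<nu>" using assms(4) by (simp add: angular_measure_def)
  interpret cube_measure \<nu> \<alpha>
    using fin sets_angular_measure[OF assms(4)] assms(2,3) by (rule cube_measureI)
  have sp: "space \<nu> = pos_sphere N" using assms(4) by (rule space_angular_measure)
  have pm: "polar_map \<alpha> \<in> measurable (radial_measure \<alpha> \<Otimes>\<^sub>M \<nu>) (restrict_space borel E0)"
    using assms(1,4) by (rule measurable_polar_map)
  have "E0 - {0..z} = E0 \<inter> (- {0..z})" by auto
  then have "E0 - {0..z} \<in> sets (restrict_space borel E0)"
    by (auto simp: sets_restrict_space)
  then have "emeasure (exponent_measure \<alpha> \<nu>) (E0 - {0..z})
      = emeasure (radial_measure \<alpha> \<Otimes>\<^sub>M \<nu>) (polar_map \<alpha> -` (E0 - {0..z}) \<inter> space (radial_measure \<alpha> \<Otimes>\<^sub>M \<nu>))"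
    unfolding exponent_measure_def by (rule emeasure_distr[OF pm])
  also have "polar_map \<alpha> -` (E0 - {0..z}) \<inter> space (radial_measure \<alpha> \<Otimes>\<^sub>M \<nu>) = exceedance_set \<epsilon> {..z}"
  proof -
    have in_E0: "polar_map \<alpha> p \<in> E0" if "p \<in> space (radial_measure \<alpha> \<Otimes>\<^sub>M \<nu>)" for p
      using measurable_space[OF pm that] by (simp add: space_restrict_space)
    have below: "polar_map \<alpha> p \<le> z"
      if p: "p \<in> space (radial_measure \<alpha> \<Otimes>\<^sub>M \<nu>)" and "\<not> \<epsilon> < fst p" for p
    proof -
      have "0 < fst p" and u: "\<And>j. 0 \<le> snd p $ j \<and> snd p $ j \<le> 1"
        using p component_bounds by (auto simp: space_pair_measure space_radial_measure)
      have "fst p * (snd p $ j) powr (1 / \<alpha>) \<le> fst p * 1" for j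
        using u \<open>0 < fst p\<close> alpha_pos by (intro mult_left_mono powr_le1) auto
      then have "fst p * (snd p $ j) powr (1 / \<alpha>) \<le> z $ j" for j
        using that(2) assms(6)[of j] by (metis mult.right_neutral not_less order_trans)
      then show ?thesis
        by (simp add: polar_map_def vec_powr_def less_eq_vec_def case_prod_beta')
    qed
    have "0 \<le> x" if "x \<in> E0" for x :: "real ^ 'n"
      using that by (simp add: E0_def nonneg_orthant_def less_eq_vec_def)
    then have "polar_map \<alpha> p \<in> E0 - {0..z} \<longleftrightarrow> \<epsilon> < fst p \<and> polar_map \<alpha> p \<notin> {..z}"
      if "p \<in> space (radial_measure \<alpha> \<Otimes>\<^sub>M \<nu>)" for p
      using in_E0[OF that] below[OF that] by auto
    then show ?thesis
      unfolding exceedance_set_def by blast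
  qed
  also have "emeasure (radial_measure \<alpha> \<Otimes>\<^sub>M \<nu>) (exceedance_set \<epsilon> {..z}) = (\<integral>\<^sup>+u. exceedance \<alpha> \<epsilon> {..z} u \<partial>\<nu>)"
    using assms(5) by (intro emeasure_exceedance_set) auto
  finally show ?thesis by (simp add: measure_def)
qed

section \<open>The Kolmogorov bound\<close>

text \<open>Replaces the extended-real derivatives behind \<open>tv_dist\<close> by nonnegative real
  integrable densities, for which differences and minima can be taken pointwise.\<close>

lemma tv_dist_densities:
  assumes "finite_measure \<nu>\<^sub>1" "finite_measure \<nu>\<^sub>2" "sets \<nu>\<^sub>2 = sets \<nu>\<^sub>1"
  obtains S w\<^sub>1 w\<^sub>2 where "sets S = sets \<nu>\<^sub>1" "w\<^sub>1 \<in> borel_measurable S" "w\<^sub>2 \<in> borel_measurable S"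
    "\<And>u. (0::real) \<le> w\<^sub>1 u" "\<And>u. (0::real) \<le> w\<^sub>2 u"
    "\<nu>\<^sub>1 = density S (\<lambda>u. ennreal (w\<^sub>1 u))" "\<nu>\<^sub>2 = density S (\<lambda>u. ennreal (w\<^sub>2 u))"
    "integrable S w\<^sub>1" "integrable S w\<^sub>2" "tv_dist \<nu>\<^sub>1 \<nu>\<^sub>2 = (\<integral>u. \<bar>w\<^sub>2 u - w\<^sub>1 u\<bar> \<partial>S)"
proof -
  interpret \<nu>\<^sub>1: finite_measure \<nu>\<^sub>1 by fact
  interpret \<nu>\<^sub>2: finite_measure \<nu>\<^sub>2 by fact
  define S where "S = sum_measure \<nu>\<^sub>1 \<nu>\<^sub>2"
  have sS: "sets S = sets \<nu>\<^sub>1" by (simp add: S_def)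
  have eS: "emeasure S A = emeasure \<nu>\<^sub>1 A + emeasure \<nu>\<^sub>2 A" if "A \<in> sets \<nu>\<^sub>1" for A
    unfolding S_def by (rule emeasure_sum_measure[OF assms(3) that])
  interpret S: finite_measure S
    using eS[of "space \<nu>\<^sub>1"] by (intro finite_measureI) (simp add: sets_eq_imp_space_eq[OF sS] \<nu>\<^sub>1.emeasure_eq_measure \<nu>\<^sub>2.emeasure_eq_measure)
  \<comment> \<open>Treats both measures at once: domination by \<open>S\<close> gives absolute
    continuity, and finiteness of \<nu> makes the derivative finite almost everywhere, so
    \<open>enn2real\<close> alters it on a null set only.\<close>
  have density: "density S (\<lambda>u. ennreal (enn2real (RN_deriv S \<nu> u))) = \<nu> \<and> integrable S (\<lambda>u. enn2real (RN_deriv S \<nu> u))"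
    if \<nu>: "finite_measure \<nu>" "sets \<nu> = sets \<nu>\<^sub>1" "\<And>A. A \<in> sets \<nu>\<^sub>1 \<Longrightarrow> emeasure \<nu> A \<le> emeasure S A" for \<nu>
  proof
    interpret \<nu>: finite_measure \<nu> by fact
    have ac: "absolutely_continuous S \<nu>"
      using \<nu>(2,3) sS unfolding absolutely_continuous_def null_sets_def
      by (auto simp: le_zero_eq) (metis le_zero_eq)
    have "AE u in S. RN_deriv S \<nu> u \<noteq> \<infinity>"
      using \<nu>.sigma_finite_measure_axioms ac \<nu>(2) sS by (intro S.RN_deriv_finite) auto
    then have "density S (\<lambda>u. ennreal (enn2real (RN_deriv S \<nu> u))) = density S (RN_deriv S \<nu>)"
      by (intro density_cong) (auto simp: less_top)
    also have "\<dots> = \<nu>" using ac \<nu>(2) sS by (intro S.density_RN_deriv) auto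
    finally show dens: "density S (\<lambda>u. ennreal (enn2real (RN_deriv S \<nu> u))) = \<nu>" .
    have "(\<integral>\<^sup>+u. ennreal (enn2real (RN_deriv S \<nu> u)) \<partial>S) = emeasure (density S (\<lambda>u. ennreal (enn2real (RN_deriv S \<nu> u)))) (space S)"
      by (subst emeasure_density) (auto intro!: nn_integral_cong)
    also have "\<dots> < \<infinity>"
      unfolding dens by (simp add: \<nu>.emeasure_eq_measure)
    finally show "integrable S (\<lambda>u. enn2real (RN_deriv S \<nu> u))"
      by (intro integrableI_nonneg) auto
  qed
  show thesis
    using density[of \<nu>\<^sub>1] density[of \<nu>\<^sub>2] assms eS
    by (intro that[of S "\<lambda>u. enn2real (RN_deriv S \<nu>\<^sub>1 u)" "\<lambda>u. enn2real (RN_deriv S \<nu>\<^sub>2 u)"])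
      (auto simp: sS tv_dist_def Let_def S_def[symmetric])
qed

text \<open>In terms of densities the difference is the integral of \<open>g\<close> times the
  difference of the densities, and \<open>g\<close> lies between 0 and \<open>m\<close>.\<close>

lemma integral_diff_le_tv_dist:
  fixes g :: "'a \<Rightarrow> real"
  assumes "finite_measure \<nu>\<^sub>1" "finite_measure \<nu>\<^sub>2" "sets \<nu>\<^sub>2 = sets \<nu>\<^sub>1"
    and "g \<in> borel_measurable \<nu>\<^sub>1" "\<And>u. 0 \<le> g u" "\<And>u. g u \<le> m"
  shows "\<bar>(\<integral>u. g u \<partial>\<nu>\<^sub>1) - (\<integral>u. g u \<partial>\<nu>\<^sub>2)\<bar> \<le> m * tv_dist \<nu>\<^sub>1 \<nu>\<^sub>2"
proof -
  obtain S w\<^sub>1 w\<^sub>2 where S: "sets S = sets \<nu>\<^sub>1" and [measurable]: "w\<^sub>1 \<in> borel_measurable S" "w\<^sub>2 \<in> borel_measurable S"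
    and w: "\<And>u. (0::real) \<le> w\<^sub>1 u" "\<And>u. (0::real) \<le> w\<^sub>2 u"
    "\<nu>\<^sub>1 = density S (\<lambda>u. ennreal (w\<^sub>1 u))" "\<nu>\<^sub>2 = density S (\<lambda>u. ennreal (w\<^sub>2 u))"
    "integrable S w\<^sub>1" "integrable S w\<^sub>2" "tv_dist \<nu>\<^sub>1 \<nu>\<^sub>2 = (\<integral>u. \<bar>w\<^sub>2 u - w\<^sub>1 u\<bar> \<partial>S)"
    by (rule tv_dist_densities[OF assms(1-3)]) (rule that)
  have g [measurable]: "g \<in> borel_measurable S"
    using assms(4) measurable_cong_sets[OF S refl] by blast
  have gw: "(\<integral>u. g u \<partial>density S (\<lambda>u. ennreal (w u))) = (\<integral>u. w u * g u \<partial>S) \<and> integrable S (\<lambda>u. w u * g u)"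
    if [measurable]: "integrable S w" and "\<And>u. 0 \<le> w u" for w
  proof
    show "(\<integral>u. g u \<partial>density S (\<lambda>u. ennreal (w u))) = (\<integral>u. w u * g u \<partial>S)"
      using that by (subst integral_density) auto
    show "integrable S (\<lambda>u. w u * g u)"
    proof (rule Bochner_Integration.integrable_bound)
      show "integrable S (\<lambda>u. m * w u)" using that by simp
      show "AE u in S. norm (w u * g u) \<le> norm (m * w u)"
        using that assms(5,6) by (auto intro!: AE_I2 mult_right_mono simp: abs_mult mult.commute[of "w _"] intro: order_trans[OF _ abs_ge_self])
    qed simp
  qed
  have "\<bar>(\<integral>u. g u \<partial>\<nu>\<^sub>1) - (\<integral>u. g u \<partial>\<nu>\<^sub>2)\<bar> = \<bar>\<integral>u. w\<^sub>1 u * g u - w\<^sub>2 u * g u \<partial>S\<bar>"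
    using gw[OF w(5,1)] gw[OF w(6,2)] w(3,4) by simp
  also have "\<dots> \<le> (\<integral>u. \<bar>w\<^sub>1 u * g u - w\<^sub>2 u * g u\<bar> \<partial>S)"
    by (rule integral_abs_bound)
  also have "\<dots> \<le> (\<integral>u. m * \<bar>w\<^sub>2 u - w\<^sub>1 u\<bar> \<partial>S)"
  proof (rule integral_mono)
    show "integrable S (\<lambda>u. \<bar>w\<^sub>1 u * g u - w\<^sub>2 u * g u\<bar>)"
      using gw[OF w(5,1)] gw[OF w(6,2)] by simp
    show "integrable S (\<lambda>u. m * \<bar>w\<^sub>2 u - w\<^sub>1 u\<bar>)" using w(5,6) by simp
    show "\<bar>w\<^sub>1 u * g u - w\<^sub>2 u * g u\<bar> \<le> m * \<bar>w\<^sub>2 u - w\<^sub>1 u\<bar>" for u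
    proof -
      have "\<bar>w\<^sub>1 u * g u - w\<^sub>2 u * g u\<bar> = g u * \<bar>w\<^sub>2 u - w\<^sub>1 u\<bar>"
        using assms(5)[of u] by (simp add: abs_mult abs_minus_commute flip: left_diff_distrib)
      also have "\<dots> \<le> m * \<bar>w\<^sub>2 u - w\<^sub>1 u\<bar>" using assms(6) by (intro mult_right_mono) auto
      finally show ?thesis .
    qed
  qed
  finally show ?thesis by (simp add: w(7))
qed

lemma tv_dist_nonneg: "0 \<le> tv_dist \<nu>\<^sub>1 \<nu>\<^sub>2"
  by (simp add: tv_dist_def Let_def)

text \<open>Since \<open>m\<close> bounds both exponents from below and also scales their
  difference, the left side is at most \<open>exp (- m) * m * D\<close>, and
  \<open>m * exp (- m) \<le> 1\<close>.\<close>

lemma abs_exp_diff_le: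
  fixes a b m D :: real
  assumes "0 \<le> m" "m \<le> a" "m \<le> b" "\<bar>a - b\<bar> \<le> m * D" "0 \<le> D"
  shows "\<bar>exp (- a) - exp (- b)\<bar> \<le> D"
proof -
  have diff: "exp (- x) - exp (- y) \<le> exp (- m) * \<bar>x - y\<bar>" if "m \<le> x" for x y
  proof -
    have "exp (- y) = exp (- x) * exp (x - y)" by (simp flip: exp_add)
    then have "exp (- x) - exp (- y) = exp (- x) * (1 - exp (x - y))" by (simp add: algebra_simps)
    also have "\<dots> \<le> exp (- x) * \<bar>x - y\<bar>"
    proof (rule mult_left_mono)
      show "1 - exp (x - y) \<le> \<bar>x - y\<bar>"
        using exp_ge_add_one_self[of "x - y"] abs_ge_minus_self[of "x - y"] by linarith
    qed simp
    also have "\<dots> \<le> exp (- m) * \<bar>x - y\<bar>" using that by (intro mult_right_mono) auto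
    finally show ?thesis .
  qed
  have "\<bar>exp (- a) - exp (- b)\<bar> \<le> exp (- m) * \<bar>a - b\<bar>"
    using diff[OF assms(2), of b] diff[OF assms(3), of a] by (simp add: abs_minus_commute)
  also have "\<dots> \<le> exp (- m) * (m * D)" using assms(4) by (intro mult_left_mono) auto
  also have "\<dots> = (m * exp (- m)) * D" by simp
  also have "\<dots> \<le> 1 * D"
  proof (intro mult_right_mono assms(5))
    have "m \<le> exp m" using exp_ge_add_one_self[of m] by linarith
    then show "m * exp (- m) \<le> 1" by (simp add: exp_minus field_simps)
  qed
  finally show ?thesis by simp
qed

text \<open>For each \<open>z\<close>, the number \<open>\<epsilon> powr (- \<alpha>)\<close> with
  \<epsilon> the smallest coordinate of \<open>z\<close> is both a uniform bound for the integrand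
  of the two exponents and a lower bound for the exponents themselves. This yields the bound without
  a dimensional factor.\<close>

lemma kolmogorov_dist_max_stable_le:
  fixes N :: "real ^ 'n::finite \<Rightarrow> real"
  assumes "is_norm N" "pos_sphere N \<subseteq> {0..1}" "\<alpha> > 0"
    and "angular_measure N \<nu>\<^sub>1" "angular_measure N \<nu>\<^sub>2"
    and "max_stable_rv \<alpha> \<nu>\<^sub>1 M\<^sub>1 Z\<^sub>1" "max_stable_rv \<alpha> \<nu>\<^sub>2 M\<^sub>2 Z\<^sub>2"
  shows "kolmogorov_dist M\<^sub>1 Z\<^sub>1 M\<^sub>2 Z\<^sub>2 \<le> tv_dist \<nu>\<^sub>1 \<nu>\<^sub>2"
  unfolding kolmogorov_dist_def
proof (rule cSUP_least)
  have "(\<chi> j. 1) \<in> (pos_orthant :: (real ^ 'n) set)" by (simp add: pos_orthant_def)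
  then show "(pos_orthant :: (real ^ 'n) set) \<noteq> {}" by blast
next
  fix z :: "real ^ 'n" assume z: "z \<in> pos_orthant"
  define \<epsilon> where "\<epsilon> = Min (range (\<lambda>j. z $ j))"
  have "\<epsilon> \<in> range (\<lambda>j. z $ j)" unfolding \<epsilon>_def by (intro Min_in) auto
  then obtain j where j: "\<epsilon> = z $ j" by blast
  have \<epsilon>: "0 < \<epsilon>" "\<And>j. \<epsilon> \<le> z $ j"
    using z j by (simp add: pos_orthant_def) (simp add: \<epsilon>_def)
  define g where "g u = enn2real (exceedance \<alpha> \<epsilon> {..z} u)" for u
  have props: "measure (exponent_measure \<alpha> \<nu>) (E0 - {0..z}) = (\<integral>u. g u \<partial>\<nu>) \<and> \<epsilon> powr (- \<alpha>) \<le> (\<integral>u. g u \<partial>\<nu>)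
      \<and> g \<in> borel_measurable \<nu> \<and> (\<forall>u. 0 \<le> g u \<and> g u \<le> \<epsilon> powr (- \<alpha>))"
    if \<nu>: "angular_measure N \<nu>" for \<nu>
  proof -
    have fin: "finite_measure \<nu>" using \<nu> by (simp add: angular_measure_def)
    interpret cube_measure \<nu> \<alpha>
      using fin sets_angular_measure[OF \<nu>] assms(2,3) by (rule cube_measureI)
    note le = exceedance_le[OF \<epsilon>(1), of "{..z}"]
    have g: "ennreal (g u) = exceedance \<alpha> \<epsilon> {..z} u" for u
      using le[of u] unfolding g_def by (intro ennreal_enn2real) (auto intro: le_less_trans)
    have gm: "g \<in> borel_measurable \<nu>"
      unfolding g_def using exceedance_measurable[OF \<epsilon>(1), of "{..z}"] by simp
    have eq: "enn2real (\<integral>\<^sup>+u. exceedance \<alpha> \<epsilon> {..z} u \<partial>\<nu>) = (\<integral>u. g u \<partial>\<nu>)"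
      using gm by (subst integral_eq_nn_integral) (auto simp: g g_def[symmetric], simp add: g_def)
    \<comment> \<open>Leaving the half-space of the minimising coordinate means leaving the box. The
      half-space has exponent \<open>\<epsilon> powr (- \<alpha>)\<close> by the moment condition,
      whence the lower bound.\<close>
    have half: "exceedance \<alpha> \<epsilon> {x. x $ j \<le> \<epsilon>} u \<le> exceedance \<alpha> \<epsilon> {..z} u" if u: "u \<in> space \<nu>" for u
    proof -
      have "(\<lambda>r. (r, u)) -` exceedance_set \<epsilon> {..z} \<in> sets (radial_measure \<alpha>)"
        using exceedance_set_measurable[of "{..z}" \<epsilon>] by (intro sets_Pair2) auto
      then show ?thesis
        unfolding exceedance_eq[OF \<epsilon>(1) u]
        by (intro emeasure_mono) (auto simp: exceedance_set_def less_eq_vec_def j)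
    qed
    have "\<epsilon> powr (- \<alpha>) = enn2real (\<integral>\<^sup>+u. exceedance \<alpha> \<epsilon> {x. x $ j \<le> \<epsilon>} u \<partial>\<nu>)"
      using \<nu> \<epsilon>(1) by (simp add: nn_integral_exceedance_halfspace angular_measure_def)
    also have "\<dots> \<le> enn2real (\<integral>\<^sup>+u. exceedance \<alpha> \<epsilon> {..z} u \<partial>\<nu>)"
      using half nn_integral_exceedance_finite[OF \<epsilon>(1), of "{..z}"]
      by (intro enn2real_mono nn_integral_mono) auto
    finally show ?thesis
      using measure_exponent_measure_compl_box[OF assms(1,2,3) \<nu> \<epsilon>] eq gm le
      by (auto simp: g_def intro!: enn2real_leI)
  qed
  have fin: "finite_measure \<nu>\<^sub>1" "finite_measure \<nu>\<^sub>2" "sets \<nu>\<^sub>2 = sets \<nu>\<^sub>1"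
    using assms(4,5) by (auto simp: angular_measure_def)
  have "\<bar>exp (- (\<integral>u. g u \<partial>\<nu>\<^sub>1)) - exp (- (\<integral>u. g u \<partial>\<nu>\<^sub>2))\<bar> \<le> tv_dist \<nu>\<^sub>1 \<nu>\<^sub>2"
    using props[OF assms(4)] props[OF assms(5)] tv_dist_nonneg
    by (intro abs_exp_diff_le[where m="\<epsilon> powr (- \<alpha>)"] integral_diff_le_tv_dist fin) auto
  then show "\<bar>measure M\<^sub>1 {\<omega> \<in> space M\<^sub>1. Z\<^sub>1 \<omega> \<le> z} - measure M\<^sub>2 {\<omega> \<in> space M\<^sub>2. Z\<^sub>2 \<omega> \<le> z}\<bar> \<le> tv_dist \<nu>\<^sub>1 \<nu>\<^sub>2"
    using assms(6,7) z props[OF assms(4)] props[OF assms(5)] by (simp add: max_stable_rv_def)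
qed

section \<open>Expected coordinate increments\<close>

lemma borel_measurable_component [measurable]: "(\<lambda>x :: real ^ 'n::finite. x $ j) \<in> borel_measurable borel"
  by simp

text \<open>The positive part of \<open>g - f\<close> is the length of the interval of all
  \<open>t\<close> with \<open>f \<le> t < g\<close>; Tonelli and independence do the rest. The
  coercion \<open>ennreal\<close> sends negative differences to 0.\<close>

lemma nn_integral_positive_part_diff:
  fixes f :: "'a \<Rightarrow> real" and g :: "'b \<Rightarrow> real"
  assumes "prob_space P" "prob_space Q"
    and [measurable]: "f \<in> borel_measurable P" "g \<in> borel_measurable Q"
  shows "(\<integral>\<^sup>+p. ennreal (g (snd p) - f (fst p)) \<partial>(P \<Otimes>\<^sub>M Q))
    = (\<integral>\<^sup>+t. emeasure P {x\<in>space P. f x \<le> t} * emeasure Q {y\<in>space Q. t < g y} \<partial>lborel)"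
proof -
  interpret P: prob_space P by fact
  interpret Q: prob_space Q by fact
  interpret PQ: pair_prob_space P Q ..
  interpret L: pair_sigma_finite "P \<Otimes>\<^sub>M Q" lborel ..
  define k :: "'a \<times> 'b \<Rightarrow> real \<Rightarrow> ennreal"
    where "k p t = indicator {q. f (fst (fst q)) \<le> snd q \<and> snd q < g (snd (fst q))} (p, t)" for p t
  have k_meas: "case_prod k \<in> borel_measurable ((P \<Otimes>\<^sub>M Q) \<Otimes>\<^sub>M lborel)"
    unfolding k_def case_prod_beta' by measurable
  have "(\<integral>\<^sup>+p. ennreal (g (snd p) - f (fst p)) \<partial>(P \<Otimes>\<^sub>M Q)) = (\<integral>\<^sup>+p. \<integral>\<^sup>+t. k p t \<partial>lborel \<partial>(P \<Otimes>\<^sub>M Q))"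
  proof (intro nn_integral_cong)
    fix p
    have "(\<integral>\<^sup>+t. k p t \<partial>lborel) = (\<integral>\<^sup>+t. indicator {f (fst p)..<g (snd p)} t \<partial>lborel)"
      by (intro nn_integral_cong) (auto simp: k_def indicator_def)
    also have "\<dots> = ennreal (g (snd p) - f (fst p))"
      by (cases "f (fst p) \<le> g (snd p)") (auto simp: ennreal_neg)
    finally show "ennreal (g (snd p) - f (fst p)) = (\<integral>\<^sup>+t. k p t \<partial>lborel)" ..
  qed
  also have "\<dots> = (\<integral>\<^sup>+t. \<integral>\<^sup>+p. k p t \<partial>(P \<Otimes>\<^sub>M Q) \<partial>lborel)"
    using k_meas by (rule L.Fubini'[symmetric])
  also have "\<dots> = (\<integral>\<^sup>+t. emeasure P {x\<in>space P. f x \<le> t} * emeasure Q {y\<in>space Q. t < g y} \<partial>lborel)"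
  proof (intro nn_integral_cong)
    fix t :: real
    have "(\<integral>\<^sup>+p. k p t \<partial>(P \<Otimes>\<^sub>M Q))
        = (\<integral>\<^sup>+p. indicator ({x\<in>space P. f x \<le> t} \<times> {y\<in>space Q. t < g y}) p \<partial>(P \<Otimes>\<^sub>M Q))"
      by (intro nn_integral_cong) (auto simp: k_def indicator_def space_pair_measure)
    also have "\<dots> = emeasure (P \<Otimes>\<^sub>M Q) ({x\<in>space P. f x \<le> t} \<times> {y\<in>space Q. t < g y})"
      by (intro nn_integral_indicator) measurable
    also have "\<dots> = emeasure P {x\<in>space P. f x \<le> t} * emeasure Q {y\<in>space Q. t < g y}"
      by (intro Q.emeasure_pair_measure_Times) measurable
    finally show "(\<integral>\<^sup>+p. k p t \<partial>(P \<Otimes>\<^sub>M Q))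
      = emeasure P {x\<in>space P. f x \<le> t} * emeasure Q {y\<in>space Q. t < g y}" .
  qed
  finally show ?thesis .
qed

text \<open>Convexity of \<open>exp\<close> between \<open>- s\<close> and 0 with weights
  \<open>1 - c\<close> and \<open>c\<close>, after subtracting \<open>exp (- s)\<close> from both
  sides.\<close>

lemma exp_mult_one_minus_exp_le:
  fixes c s :: real
  assumes "0 \<le> c" "c \<le> 1"
  shows "exp (- ((1 - c) * s)) * (1 - exp (- (c * s))) \<le> c * (1 - exp (- s))"
proof -
  have "exp ((1 - c) *\<^sub>R (- s) + c *\<^sub>R 0) \<le> (1 - c) * exp (- s) + c * exp 0"
    using assms by (intro convex_onD[OF exp_convex]) auto
  then have "exp (- ((1 - c) * s)) \<le> (1 - c) * exp (- s) + c" by simp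
  moreover have "exp (- ((1 - c) * s)) * exp (- (c * s)) = exp (- s)"
    by (simp add: algebra_simps flip: exp_add)
  ultimately show ?thesis by (simp add: algebra_simps)
qed

section \<open>Marginals of the truncated laws\<close>

context cube_measure
begin

text \<open>From level \<epsilon> upwards a coordinate keeps its Frechet distribution function, with
  the \<open>j\<close>-th moment of \<rho> as scale; the indicator is 1 because the half-space
  contains the constant vector \<epsilon>.\<close>

lemma truncation_halfspace:
  assumes "max_stable_truncation \<alpha> \<epsilon> \<rho> P" "0 < \<epsilon>" "\<epsilon> \<le> t"
  shows "emeasure P {x. x $ j \<le> t} = ennreal (exp (- ((\<integral>u. u $ j \<partial>\<rho>) * t powr (- \<alpha>))))"
    and "emeasure P {x. t < x $ j} = ennreal (1 - exp (- ((\<integral>u. u $ j \<partial>\<rho>) * t powr (- \<alpha>))))"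
proof -
  have P: "prob_space P" "sets P = sets borel" using assms(1) by (auto simp: max_stable_truncation_def)
  interpret P: prob_space P by fact
  have sp: "space P = UNIV" using sets_eq_imp_space_eq[OF P(2)] by simp
  have H: "{x::real ^ 'n. x $ j \<le> t} \<in> sets borel" by simp
  have "0 \<le> (\<integral>u. u $ j \<partial>\<rho>)"
    using component_bounds by (intro integral_nonneg_AE) (auto intro!: AE_I2)
  then show *: "emeasure P {x. x $ j \<le> t} = ennreal (exp (- ((\<integral>u. u $ j \<partial>\<rho>) * t powr (- \<alpha>))))"
    using assms H sup_closed_halfspace[of j t]
    by (simp add: max_stable_truncation_def nn_integral_exceedance_halfspace)
  have "{x::real ^ 'n. t < x $ j} = space P - {x. x $ j \<le> t}" using sp by auto
  then have "emeasure P {x. t < x $ j} = 1 - emeasure P {x. x $ j \<le> t}"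
    using H P(2) by (simp add: emeasure_compl P.emeasure_space_1)
  then show "emeasure P {x. t < x $ j} = ennreal (1 - exp (- ((\<integral>u. u $ j \<partial>\<rho>) * t powr (- \<alpha>))))"
    by (simp add: * ennreal_minus flip: ennreal_1)
qed

end

text \<open>The open half-space is \<open>sup_closed\<close> and misses the constant vector
  \<epsilon>, so the indicator annihilates its probability.\<close>

lemma truncation_component_below:
  assumes "max_stable_truncation \<alpha> \<epsilon> \<rho> P"
  shows "emeasure P {x. x $ j < \<epsilon>} = 0"
proof -
  have "sup_closed {x :: real ^ 'a. x $ j < \<epsilon>}" by (simp add: sup_closed_def sup_vec_def sup_max)
  then show ?thesis using assms by (simp add: max_stable_truncation_def)
qed

lemma truncation_AE_ge:
  assumes "max_stable_truncation \<alpha> \<epsilon> \<rho> P"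
  shows "AE x in P. \<epsilon> \<le> x $ j"
proof (rule AE_I[where N="{x. x $ j < \<epsilon>}"])
  have sets: "sets P = sets borel" using assms by (simp add: max_stable_truncation_def)
  then show "{x. x $ j < \<epsilon>} \<in> sets P" by simp
qed (use truncation_component_below[OF assms] in auto)

text \<open>The excess over \<epsilon> has a tail below that of a unit Frechet variable, whose mean
  is finite for \<alpha> > 1.\<close>

lemma integrable_truncation_component:
  assumes "cube_measure \<rho> \<alpha>" "max_stable_truncation \<alpha> \<epsilon> \<rho> P" "0 < \<epsilon>" "1 < \<alpha>" "(\<integral>u. u $ j \<partial>\<rho>) \<le> 1"
  shows "integrable P (\<lambda>x. x $ j)"
proof -
  interpret cube_measure \<rho> \<alpha> by fact
  have P: "prob_space P" and s [measurable_cong]: "sets P = sets borel"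
    using assms(2) by (auto simp: max_stable_truncation_def)
  interpret P: prob_space P by fact
  interpret PP: pair_prob_space P P ..
  have sp: "space P = UNIV" using sets_eq_imp_space_eq[OF s] by simp
  define c where "c = (\<integral>u. u $ j \<partial>\<rho>)"
  \<comment> \<open>The first factor of the product is a dummy: it lets the formula for independent
    pairs apply with the constant \<epsilon> as the smaller variable.\<close>
  have "(\<integral>\<^sup>+x. ennreal (x $ j - \<epsilon>) \<partial>P) = (\<integral>\<^sup>+p. ennreal (snd p $ j - \<epsilon>) \<partial>(P \<Otimes>\<^sub>M P))"
    by (subst P.nn_integral_fst[symmetric], measurable) (simp add: P.emeasure_space_1)
  also have "\<dots> = (\<integral>\<^sup>+t. emeasure P {x\<in>space P. \<epsilon> \<le> t} * emeasure P {y\<in>space P. t < y $ j} \<partial>lborel)"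
    by (rule nn_integral_positive_part_diff[OF P P, of "\<lambda>_. \<epsilon>"]) measurable
  also have "\<dots> \<le> (\<integral>\<^sup>+t. ennreal (1 - exp (- (t powr (- \<alpha>)))) * indicator {0<..} t \<partial>lborel)"
  proof (rule nn_integral_mono)
    fix t :: real
    show "emeasure P {x\<in>space P. \<epsilon> \<le> t} * emeasure P {y\<in>space P. t < y $ j}
        \<le> ennreal (1 - exp (- (t powr (- \<alpha>)))) * indicator {0<..} t"
    proof (cases "\<epsilon> \<le> t")
      case True
      have "c * t powr (- \<alpha>) \<le> 1 * t powr (- \<alpha>)" using assms(5) by (intro mult_right_mono) (auto simp: c_def)
      then show ?thesis
        using True assms(3) truncation_halfspace(2)[OF assms(2,3) True, of j] P.emeasure_space_1
        by (simp add: sp c_def ennreal_leI)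
    qed simp
  qed
  also have "\<dots> < \<infinity>" by (simp add: nn_integral_lborel_Ioi_one_minus_exp[OF assms(4)])
  finally have fin: "(\<integral>\<^sup>+x. ennreal (x $ j - \<epsilon>) \<partial>P) < \<infinity>" .
  have "(\<lambda>x. x $ j - \<epsilon>) \<in> borel_measurable P" by measurable
  then have "integrable P (\<lambda>x. x $ j - \<epsilon>)"
    using fin truncation_AE_ge[OF assms(2), of j] by (intro integrableI_nonneg) auto
  then have "integrable P (\<lambda>x. (x $ j - \<epsilon>) + \<epsilon>)" by (intro Bochner_Integration.integrable_add) auto
  then show ?thesis by simp
qed

text \<open>The increase of a coordinate from \<open>Z\<^sub>0\<close> to \<open>sup Z\<^sub>0 R\<close> has expectation
  \<open>\<integral> \<P>(Z\<^sub>0 \<le> t < R) dt\<close>, and convexity of \<open>exp\<close> bounds the integrand linearly in the mass of \<open>\<rho>\<close>.\<close>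

lemma nn_integral_sup_increment_le:
  assumes "cube_measure \<nu>\<^sub>0 \<alpha>" "cube_measure \<rho> \<alpha>"
    and P: "max_stable_truncation \<alpha> \<epsilon> \<nu>\<^sub>0 P" and Q: "max_stable_truncation \<alpha> \<epsilon> \<rho> Q"
    and "0 < \<epsilon>" "1 < \<alpha>" "(\<integral>u. u $ j \<partial>\<nu>\<^sub>0) + (\<integral>u. u $ j \<partial>\<rho>) = 1"
  shows "(\<integral>\<^sup>+p. ennreal (snd p $ j - fst p $ j) \<partial>(P \<Otimes>\<^sub>M Q))
    \<le> ennreal ((\<integral>u. u $ j \<partial>\<rho>) * Gamma (1 - 1 / \<alpha>))"
proof -
  interpret \<nu>\<^sub>0: cube_measure \<nu>\<^sub>0 \<alpha> by fact
  interpret \<rho>: cube_measure \<rho> \<alpha> by fact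
  have PP: "prob_space P" "prob_space Q" and s [measurable_cong]: "sets P = sets borel" "sets Q = sets borel"
    using P Q by (auto simp: max_stable_truncation_def)
  have sp: "space P = UNIV" "space Q = UNIV"
    using sets_eq_imp_space_eq[OF s(1)] sets_eq_imp_space_eq[OF s(2)] by auto
  define c where "c = (\<integral>u. u $ j \<partial>\<rho>)"
  have "0 \<le> (\<integral>u. u $ j \<partial>\<nu>\<^sub>0)" "0 \<le> c"
    using \<nu>\<^sub>0.component_bounds \<rho>.component_bounds unfolding c_def
    by (auto intro!: integral_nonneg_AE AE_I2)
  then have c: "0 \<le> c" "c \<le> 1" and c0: "(\<integral>u. u $ j \<partial>\<nu>\<^sub>0) = 1 - c"
    using assms(7) by (auto simp: c_def)
  have "(\<integral>\<^sup>+p. ennreal (snd p $ j - fst p $ j) \<partial>(P \<Otimes>\<^sub>M Q))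
      = (\<integral>\<^sup>+t. emeasure P {x\<in>space P. x $ j \<le> t} * emeasure Q {y\<in>space Q. t < y $ j} \<partial>lborel)"
    by (rule nn_integral_positive_part_diff[OF PP]) measurable
  also have "\<dots> \<le> (\<integral>\<^sup>+t. ennreal c * (ennreal (1 - exp (- (t powr (- \<alpha>)))) * indicator {0<..} t) \<partial>lborel)"
  proof (rule nn_integral_mono)
    fix t :: real
    let ?s = "t powr (- \<alpha>)"
    show "emeasure P {x\<in>space P. x $ j \<le> t} * emeasure Q {y\<in>space Q. t < y $ j}
        \<le> ennreal c * (ennreal (1 - exp (- ?s)) * indicator {0<..} t)"
    proof (cases "\<epsilon> \<le> t")
      case True
      \<comment> \<open>The moments of the two parts are \<open>1 - c\<close> and \<open>c\<close>,
        which is the form required by \<open>exp_mult_one_minus_exp_le\<close>.\<close>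
      have "emeasure P {x. x $ j \<le> t} * emeasure Q {y. t < y $ j}
          = ennreal (exp (- ((1 - c) * ?s)) * (1 - exp (- (c * ?s))))"
        using \<nu>\<^sub>0.truncation_halfspace(1)[OF P assms(5) True, of j]
          \<rho>.truncation_halfspace(2)[OF Q assms(5) True, of j]
        by (simp add: c0 c_def ennreal_mult')
      also have "\<dots> \<le> ennreal (c * (1 - exp (- ?s)))"
        by (intro ennreal_leI exp_mult_one_minus_exp_le c)
      finally show ?thesis using True assms(5) c by (simp add: sp ennreal_mult')
    next
      case False
      \<comment> \<open>Below \<epsilon> the integrand vanishes, since \<open>P\<close> puts no mass
        on values of the coordinate smaller than \<epsilon>.\<close>
      have "emeasure P {x. x $ j \<le> t} \<le> emeasure P {x. x $ j < \<epsilon>}"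
        using False s by (intro emeasure_mono) auto
      then show ?thesis using truncation_component_below[OF P, of j] by (simp add: sp)
    qed
  qed
  also have "\<dots> = ennreal c * ennreal (Gamma (1 - 1 / \<alpha>))"
    using nn_integral_lborel_Ioi_one_minus_exp[OF assms(6)] by (subst nn_integral_cmult) auto
  finally show ?thesis using c by (simp add: c_def ennreal_mult')
qed

section \<open>Comparison of expectations\<close>

text \<open>Lower orthants generate the Borel sets and are stable under intersection, and those with
  integer corners exhaust the space.\<close>

lemma measure_eqI_atMost:
  fixes P Q :: "(real ^ 'n::finite) measure"
  assumes "finite_measure P" "sets P = sets borel" "sets Q = sets borel"
    and "\<And>z. emeasure P {..z} = emeasure Q {..z}"
  shows "P = Q"
proof -
  interpret P: finite_measure P by fact
  let ?E = "range (\<lambda>z :: real ^ 'n. {..z})"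
  let ?A = "\<lambda>k::nat. {..(\<chi> j. real k) :: real ^ 'n}"
  have borel: "sets (borel :: (real ^ 'n) measure) = sigma_sets UNIV ?E"
    unfolding borel_eq_atMost by (rule sets_measure_of) auto
  show ?thesis
  proof (rule measure_eqI_generator_eq[where \<Omega>=UNIV and E="?E" and A="?A"])
    have "{..a} \<inter> {..b} = {..inf a b}" for a b :: "real ^ 'n" by auto
    then show "Int_stable ?E" unfolding Int_stable_def by auto
    have "\<exists>k::nat. x \<le> (\<chi> j. real k)" for x :: "real ^ 'n"
    proof -
      obtain k :: nat where "norm x \<le> real k" using real_arch_simple by blast
      then have "x $ j \<le> real k" for j using component_le_norm_cart[of x j] by linarith
      then show ?thesis by (auto simp: less_eq_vec_def)
    qed
    then show "(\<Union>k. ?A k) = UNIV" by auto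
    show "emeasure P (?A k) \<noteq> \<infinity>" for k by simp
  qed (use assms borel in auto)
qed

text \<open>On lower orthants the exponents of the two pieces add up by \<open>split\<close>, so the
  probabilities multiply as for a maximum of independent vectors. This realises the truncation of
  \<open>Z\<close> in law without constructing \<open>Z\<close> from a Poisson process.\<close>

lemma law_of_truncated_max_stable:
  fixes N :: "real ^ 'n::finite \<Rightarrow> real"
  assumes "is_norm N" "pos_sphere N \<subseteq> {0..1}" "\<alpha> > 0" "angular_measure N \<nu>"
    and M: "prob_space M" and Z: "max_stable_rv \<alpha> \<nu> M Z" and \<epsilon>: "0 < \<epsilon>"
    and \<nu>\<^sub>0: "cube_measure \<nu>\<^sub>0 \<alpha>" and \<rho>: "cube_measure \<rho> \<alpha>"
    and split: "\<And>f. f \<in> borel_measurable \<nu> \<Longrightarrow> (\<integral>\<^sup>+u. f u \<partial>\<nu>) = (\<integral>\<^sup>+u. f u \<partial>\<nu>\<^sub>0) + (\<integral>\<^sup>+u. f u \<partial>\<rho>)"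
    and P: "max_stable_truncation \<alpha> \<epsilon> \<nu>\<^sub>0 P" and Q: "max_stable_truncation \<alpha> \<epsilon> \<rho> Q"
  shows "distr M borel (\<lambda>\<omega>. sup (\<chi> j. \<epsilon>) (Z \<omega>)) = sup_convolution P Q"
proof (rule measure_eqI_atMost)
  let ?e = "(\<chi> j. \<epsilon>) :: real ^ 'n"
  interpret M: prob_space M by fact
  interpret \<nu>\<^sub>0: cube_measure \<nu>\<^sub>0 \<alpha> by fact
  interpret \<rho>: cube_measure \<rho> \<alpha> by fact
  interpret \<nu>: cube_measure \<nu> \<alpha>
    by (rule cube_measureI[OF _ sets_angular_measure[OF assms(4)] assms(2,3)])
      (use assms(4) in \<open>simp add: angular_measure_def\<close>)
  have Zm: "Z \<in> borel_measurable M"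
    using Z measurable_restrict_space2_iff[of Z M borel] by (auto simp: max_stable_rv_def)
  have sZm: "(\<lambda>\<omega>. sup ?e (Z \<omega>)) \<in> borel_measurable M"
    using measurable_compose[OF measurable_Pair[OF measurable_const Zm] borel_measurable_sup_vec, of ?e] by simp
  then show "finite_measure (distr M borel (\<lambda>\<omega>. sup ?e (Z \<omega>)))"
    by (rule M.finite_measure_distr)
  show "emeasure (distr M borel (\<lambda>\<omega>. sup ?e (Z \<omega>))) {..z} = emeasure (sup_convolution P Q) {..z}" for z
  proof -
    have "emeasure (sup_convolution P Q) {..z} = emeasure P {..z} * emeasure Q {..z}"
      using P Q by (intro emeasure_sup_convolution sup_closed_atMost) (auto simp: max_stable_truncation_def)
    also have "\<dots> = indicator {..z} ?e *
        ennreal (exp (- enn2real (\<integral>\<^sup>+u. exceedance \<alpha> \<epsilon> {..z} u \<partial>\<nu>\<^sub>0))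
          * exp (- enn2real (\<integral>\<^sup>+u. exceedance \<alpha> \<epsilon> {..z} u \<partial>\<rho>)))"
      using P Q sup_closed_atMost[of z] by (auto simp: max_stable_truncation_def ennreal_mult' indicator_def)
    also have "\<dots> = indicator {..z} ?e * ennreal (exp (- enn2real (\<integral>\<^sup>+u. exceedance \<alpha> \<epsilon> {..z} u \<partial>\<nu>)))"
      using \<nu>\<^sub>0.nn_integral_exceedance_finite[OF \<epsilon>, of "{..z}"] \<rho>.nn_integral_exceedance_finite[OF \<epsilon>, of "{..z}"]
        split[OF \<nu>.exceedance_measurable[OF \<epsilon>, of "{..z}"]]
      by (simp add: enn2real_plus flip: exp_add)
    \<comment> \<open>If \<open>z\<close> fails to dominate the constant vector \<epsilon>, both
      sides are 0; otherwise \<open>sup ?e (Z \<omega>) \<le> z\<close> reduces to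
      \<open>Z \<omega> \<le> z\<close>.\<close>
    also have "\<dots> = emeasure M {\<omega>\<in>space M. sup ?e (Z \<omega>) \<le> z}"
    proof (cases "?e \<le> z")
      case True
      then have ez: "\<epsilon> \<le> z $ j" for j by (simp add: less_eq_vec_def)
      then have "z \<in> pos_orthant" using \<epsilon> by (auto simp: pos_orthant_def intro: less_le_trans)
      then have "measure M {\<omega>\<in>space M. Z \<omega> \<le> z} = exp (- enn2real (\<integral>\<^sup>+u. exceedance \<alpha> \<epsilon> {..z} u \<partial>\<nu>))"
        using Z measure_exponent_measure_compl_box[OF assms(1-4) \<epsilon>, of z] ez by (simp add: max_stable_rv_def)
      then show ?thesis using True by (simp add: M.emeasure_eq_measure)
    qed simp
    also have "\<dots> = emeasure (distr M borel (\<lambda>\<omega>. sup ?e (Z \<omega>))) {..z}"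
      by (subst emeasure_distr[OF sZm]) (auto intro!: arg_cong[where f="emeasure M"])
    finally show ?thesis ..
  qed
qed simp_all

section \<open>Lipschitz expectations under coupling and truncation\<close>

lemma borel_measurable_lipschitz_norm1:
  fixes k :: "real ^ 'n::finite \<Rightarrow> real"
  assumes "\<And>x y. \<bar>k x - k y\<bar> \<le> norm1 (x - y)"
  shows "k \<in> borel_measurable borel"
proof -
  have "norm1 x \<le> real CARD('n) * norm x" for x :: "real ^ 'n"
    unfolding norm1_def using sum_bounded_above[of UNIV "\<lambda>j. \<bar>x $ j\<bar>" "norm x"] component_le_norm_cart by auto
  then have "(real CARD('n))-lipschitz_on UNIV k"
    using assms by (intro lipschitz_onI) (auto simp: dist_norm intro: order_trans)
  then show ?thesis
    by (intro borel_measurable_continuous_onI lipschitz_on_continuous_on)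
qed

text \<open>Under the product law, the first coordinate and the maximum form a coupling of
  \<open>P\<close> with \<open>sup_convolution P Q\<close>. Their distance in \<open>norm1\<close>
  is the sum of the coordinate increments, whose means are already bounded.\<close>

lemma expectation_sup_convolution_diff_le:
  fixes k :: "real ^ 'n::finite \<Rightarrow> real"
  assumes \<nu>\<^sub>0: "cube_measure \<nu>\<^sub>0 \<alpha>" and \<rho>: "cube_measure \<rho> \<alpha>"
    and P: "max_stable_truncation \<alpha> \<epsilon> \<nu>\<^sub>0 P" and Q: "max_stable_truncation \<alpha> \<epsilon> \<rho> Q"
    and "0 < \<epsilon>" "1 < \<alpha>" and mass: "\<And>j. (\<integral>u. u $ j \<partial>\<nu>\<^sub>0) + (\<integral>u. u $ j \<partial>\<rho>) = 1"
    and k: "\<And>x y. \<bar>k x - k y\<bar> \<le> norm1 (x - y)"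
  shows "integrable (sup_convolution P Q) k"
    and "\<bar>(\<integral>x. k x \<partial>sup_convolution P Q) - (\<integral>x. k x \<partial>P)\<bar>
      \<le> (\<Sum>j\<in>UNIV. (\<integral>u. u $ j \<partial>\<rho>)) * Gamma (1 - 1 / \<alpha>)"
proof -
  interpret \<nu>\<^sub>0: cube_measure \<nu>\<^sub>0 \<alpha> by fact
  interpret \<rho>: cube_measure \<rho> \<alpha> by fact
  have PP: "prob_space P" "prob_space Q" and s [measurable_cong]: "sets P = sets borel" "sets Q = sets borel"
    using P Q by (auto simp: max_stable_truncation_def)
  interpret P: prob_space P by fact
  interpret Q: prob_space Q by fact
  interpret PQ: pair_prob_space P Q ..
  have k_meas [measurable]: "k \<in> borel_measurable borel" using k by (rule borel_measurable_lipschitz_norm1)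
  have k_bound: "\<bar>k x\<bar> \<le> \<bar>k 0\<bar> + norm1 x" for x
    using k[of x 0] by simp
  have rho_nonneg: "0 \<le> (\<integral>u. u $ j \<partial>\<rho>)" and nu_nonneg: "0 \<le> (\<integral>u. u $ j \<partial>\<nu>\<^sub>0)" for j
    using \<nu>\<^sub>0.component_bounds \<rho>.component_bounds by (auto intro!: integral_nonneg_AE AE_I2)
  \<comment> \<open>Integrability is established first, so that no Bochner integral below takes its
    default value 0.\<close>
  have comp: "integrable P (\<lambda>x. x $ j)" for j
    using \<nu>\<^sub>0 P assms(5,6) by (rule integrable_truncation_component) (use mass[of j] rho_nonneg[of j] in simp)
  have kP: "integrable P k"
  proof (rule Bochner_Integration.integrable_bound)
    show "integrable P (\<lambda>x. \<bar>k 0\<bar> + norm1 x)"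
      unfolding norm1_def using comp by simp
    show "AE x in P. norm (k x) \<le> norm (\<bar>k 0\<bar> + norm1 x)"
      by (rule AE_I2) (use k_bound in \<open>auto intro: order_trans[OF _ abs_ge_self]\<close>)
  qed measurable
  have sup_meas: "(\<lambda>p. sup (fst p) (snd p)) \<in> borel_measurable (P \<Otimes>\<^sub>M Q)"
    using measurable_sup_pair[OF s] by (simp add: case_prod_beta')
  define D where "D p = (\<Sum>j\<in>UNIV. max 0 (snd p $ j - fst p $ j))" for p :: "(real ^ 'n) \<times> (real ^ 'n)"
  have D: "integrable (P \<Otimes>\<^sub>M Q) D" "(\<integral>p. D p \<partial>(P \<Otimes>\<^sub>M Q)) \<le> (\<Sum>j\<in>UNIV. (\<integral>u. u $ j \<partial>\<rho>)) * Gamma (1 - 1 / \<alpha>)"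
  proof -
    have Dj: "integrable (P \<Otimes>\<^sub>M Q) (\<lambda>p. max 0 (snd p $ j - fst p $ j)) \<and>
        (\<integral>p. max 0 (snd p $ j - fst p $ j) \<partial>(P \<Otimes>\<^sub>M Q)) \<le> (\<integral>u. u $ j \<partial>\<rho>) * Gamma (1 - 1 / \<alpha>)" for j
    proof -
      have G: "0 \<le> Gamma (1 - 1 / \<alpha>)" using assms(6) by (intro Gamma_real_nonneg) auto
      have le: "(\<integral>\<^sup>+p. ennreal (max 0 (snd p $ j - fst p $ j)) \<partial>(P \<Otimes>\<^sub>M Q)) \<le> ennreal ((\<integral>u. u $ j \<partial>\<rho>) * Gamma (1 - 1 / \<alpha>))"
        using nn_integral_sup_increment_le[OF \<nu>\<^sub>0 \<rho> P Q assms(5,6) mass] by (simp add: ennreal_def max.assoc[symmetric])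
      have m: "(\<lambda>p. max 0 (snd p $ j - fst p $ j)) \<in> borel_measurable (P \<Otimes>\<^sub>M Q)" by measurable
      have "integrable (P \<Otimes>\<^sub>M Q) (\<lambda>p. max 0 (snd p $ j - fst p $ j))"
        using m le by (intro integrableI_nonneg) (auto intro: le_less_trans)
      moreover have "(\<integral>p. max 0 (snd p $ j - fst p $ j) \<partial>(P \<Otimes>\<^sub>M Q)) \<le> (\<integral>u. u $ j \<partial>\<rho>) * Gamma (1 - 1 / \<alpha>)"
        using m le G rho_nonneg by (subst integral_eq_nn_integral) (auto intro!: enn2real_leI)
      ultimately show ?thesis by blast
    qed
    show "integrable (P \<Otimes>\<^sub>M Q) D" unfolding D_def using Dj by simp
    show "(\<integral>p. D p \<partial>(P \<Otimes>\<^sub>M Q)) \<le> (\<Sum>j\<in>UNIV. (\<integral>u. u $ j \<partial>\<rho>)) * Gamma (1 - 1 / \<alpha>)"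
      unfolding D_def sum_distrib_right using Dj by (subst Bochner_Integration.integral_sum) (auto intro!: sum_mono)
  qed
  have kD: "\<bar>k (sup (fst p) (snd p)) - k (fst p)\<bar> \<le> D p" for p
  proof -
    have "norm1 (sup (fst p) (snd p) - fst p) = D p"
      unfolding norm1_def D_def by (intro sum.cong) (auto simp: sup_vec_def sup_max)
    then show ?thesis using k[of "sup (fst p) (snd p)" "fst p"] by simp
  qed
  have kfst: "integrable (P \<Otimes>\<^sub>M Q) (\<lambda>p. k (fst p))" "(\<integral>p. k (fst p) \<partial>(P \<Otimes>\<^sub>M Q)) = (\<integral>x. k x \<partial>P)"
  proof -
    have "distr (P \<Otimes>\<^sub>M Q) P fst = P" by (rule Q.distr_pair_fst)
    then show "integrable (P \<Otimes>\<^sub>M Q) (\<lambda>p. k (fst p))" "(\<integral>p. k (fst p) \<partial>(P \<Otimes>\<^sub>M Q)) = (\<integral>x. k x \<partial>P)"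
      using kP integrable_distr_eq[OF measurable_fst, of k P Q] integral_distr[OF measurable_fst, of k P Q] by auto
  qed
  have diff: "integrable (P \<Otimes>\<^sub>M Q) (\<lambda>p. k (sup (fst p) (snd p)) - k (fst p))"
  proof (rule Bochner_Integration.integrable_bound[OF D(1)])
    show "(\<lambda>p. k (sup (fst p) (snd p)) - k (fst p)) \<in> borel_measurable (P \<Otimes>\<^sub>M Q)"
      using measurable_compose[OF sup_meas k_meas] kfst(1) by auto
    show "AE p in P \<Otimes>\<^sub>M Q. norm (k (sup (fst p) (snd p)) - k (fst p)) \<le> norm (D p)"
      by (rule AE_I2) (use kD in \<open>auto intro: order_trans[OF _ abs_ge_self]\<close>)
  qed
  have ksup: "integrable (P \<Otimes>\<^sub>M Q) (\<lambda>p. k (sup (fst p) (snd p)))"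
    using Bochner_Integration.integrable_add[OF diff kfst(1)] by simp
  then show "integrable (sup_convolution P Q) k"
    unfolding sup_convolution_def case_prod_beta' using integrable_distr_eq[OF sup_meas k_meas] by simp
  have "(\<integral>x. k x \<partial>sup_convolution P Q) = (\<integral>p. k (sup (fst p) (snd p)) \<partial>(P \<Otimes>\<^sub>M Q))"
    unfolding sup_convolution_def case_prod_beta' by (rule integral_distr[OF sup_meas k_meas])
  then have "\<bar>(\<integral>x. k x \<partial>sup_convolution P Q) - (\<integral>x. k x \<partial>P)\<bar>
      = \<bar>\<integral>p. k (sup (fst p) (snd p)) - k (fst p) \<partial>(P \<Otimes>\<^sub>M Q)\<bar>"
    using ksup kfst by simp
  also have "\<dots> \<le> (\<integral>p. \<bar>k (sup (fst p) (snd p)) - k (fst p)\<bar> \<partial>(P \<Otimes>\<^sub>M Q))" by (rule integral_abs_bound)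
  also have "\<dots> \<le> (\<integral>p. D p \<partial>(P \<Otimes>\<^sub>M Q))"
    using diff D(1) kD by (intro integral_mono) auto
  finally show "\<bar>(\<integral>x. k x \<partial>sup_convolution P Q) - (\<integral>x. k x \<partial>P)\<bar>
      \<le> (\<Sum>j\<in>UNIV. (\<integral>u. u $ j \<partial>\<rho>)) * Gamma (1 - 1 / \<alpha>)"
    using D(2) by linarith
qed

text \<open>Raising a nonnegative vector to level \<epsilon> moves each coordinate by at most
  \<epsilon>.\<close>

lemma expectation_truncation_diff_le:
  fixes Z :: "'a \<Rightarrow> real ^ 'n::finite" and k :: "real ^ 'n::finite \<Rightarrow> real"
  assumes "prob_space M" "Z \<in> borel_measurable M" "\<And>\<omega>. \<omega> \<in> space M \<Longrightarrow> 0 \<le> Z \<omega>" "0 \<le> \<epsilon>"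
    and k: "\<And>x y. \<bar>k x - k y\<bar> \<le> norm1 (x - y)"
    and int: "integrable M (\<lambda>\<omega>. k (sup (\<chi> j. \<epsilon>) (Z \<omega>)))"
  shows "\<bar>(\<integral>\<omega>. k (Z \<omega>) \<partial>M) - (\<integral>\<omega>. k (sup (\<chi> j. \<epsilon>) (Z \<omega>)) \<partial>M)\<bar> \<le> real CARD('n) * \<epsilon>"
proof -
  interpret prob_space M by fact
  let ?Y = "\<lambda>\<omega>. sup (\<chi> j. \<epsilon>) (Z \<omega>)"
  have k_meas: "k \<in> borel_measurable borel" using k by (rule borel_measurable_lipschitz_norm1)
  have diff: "\<bar>k (Z \<omega>) - k (?Y \<omega>)\<bar> \<le> real CARD('n) * \<epsilon>" if "\<omega> \<in> space M" for \<omega>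
  proof -
    have "\<bar>(Z \<omega> - ?Y \<omega>) $ j\<bar> \<le> \<epsilon>" for j
      using assms(3)[OF that] assms(4) by (auto simp: sup_vec_def sup_max less_eq_vec_def max_def)
    then have "norm1 (Z \<omega> - ?Y \<omega>) \<le> real CARD('n) * \<epsilon>"
      unfolding norm1_def using sum_bounded_above[of UNIV "\<lambda>j. \<bar>(Z \<omega> - ?Y \<omega>) $ j\<bar>" \<epsilon>] by simp
    then show ?thesis using k[of "Z \<omega>" "?Y \<omega>"] by linarith
  qed
  \<comment> \<open>The bounded difference transfers integrability from the truncated vector to
    \<open>Z\<close> itself.\<close>
  have id: "integrable M (\<lambda>\<omega>. k (Z \<omega>) - k (?Y \<omega>))"
    using diff measurable_compose[OF assms(2) k_meas] int
    by (intro integrable_const_bound[where B="real CARD('n) * \<epsilon>"]) (auto intro!: AE_I2)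
  have "integrable M (\<lambda>\<omega>. k (Z \<omega>))" using Bochner_Integration.integrable_add[OF id int] by simp
  then have "\<bar>(\<integral>\<omega>. k (Z \<omega>) \<partial>M) - (\<integral>\<omega>. k (?Y \<omega>) \<partial>M)\<bar> = \<bar>\<integral>\<omega>. k (Z \<omega>) - k (?Y \<omega>) \<partial>M\<bar>"
    using int by simp
  also have "\<dots> \<le> (\<integral>\<omega>. \<bar>k (Z \<omega>) - k (?Y \<omega>)\<bar> \<partial>M)" by (rule integral_abs_bound)
  also have "\<dots> \<le> (\<integral>\<omega>. real CARD('n) * \<epsilon> \<partial>M)"
    using id diff by (intro integral_mono) auto
  finally show ?thesis by (simp add: prob_space)
qed

section \<open>The Wasserstein bound\<close>

text \<open>The common part has the minimum of the two densities, and the residuals have what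
  remains. The decomposition is expressed through integrals of nonnegative functions, which is how
  exceedances and moments use it.\<close>

lemma common_part_decomposition:
  assumes "finite_measure \<nu>\<^sub>1" "finite_measure \<nu>\<^sub>2" "sets \<nu>\<^sub>2 = sets \<nu>\<^sub>1"
  obtains \<nu>\<^sub>0 \<rho>\<^sub>1 \<rho>\<^sub>2 where "finite_measure \<nu>\<^sub>0" "finite_measure \<rho>\<^sub>1" "finite_measure \<rho>\<^sub>2"
    "sets \<nu>\<^sub>0 = sets \<nu>\<^sub>1" "sets \<rho>\<^sub>1 = sets \<nu>\<^sub>1" "sets \<rho>\<^sub>2 = sets \<nu>\<^sub>1"
    "\<And>f. f \<in> borel_measurable \<nu>\<^sub>1 \<Longrightarrow> (\<integral>\<^sup>+u. f u \<partial>\<nu>\<^sub>1) = (\<integral>\<^sup>+u. f u \<partial>\<nu>\<^sub>0) + (\<integral>\<^sup>+u. f u \<partial>\<rho>\<^sub>1)"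
    "\<And>f. f \<in> borel_measurable \<nu>\<^sub>1 \<Longrightarrow> (\<integral>\<^sup>+u. f u \<partial>\<nu>\<^sub>2) = (\<integral>\<^sup>+u. f u \<partial>\<nu>\<^sub>0) + (\<integral>\<^sup>+u. f u \<partial>\<rho>\<^sub>2)"
    "\<And>f. f \<in> borel_measurable \<nu>\<^sub>1 \<Longrightarrow> \<forall>u\<in>space \<nu>\<^sub>1. f u \<le> 1 \<Longrightarrow>
      (\<integral>\<^sup>+u. f u \<partial>\<rho>\<^sub>1) + (\<integral>\<^sup>+u. f u \<partial>\<rho>\<^sub>2) \<le> ennreal (tv_dist \<nu>\<^sub>1 \<nu>\<^sub>2)"
proof -
  obtain S w\<^sub>1 w\<^sub>2 where S: "sets S = sets \<nu>\<^sub>1" and [measurable]: "w\<^sub>1 \<in> borel_measurable S" "w\<^sub>2 \<in> borel_measurable S"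
    and w: "\<And>u. (0::real) \<le> w\<^sub>1 u" "\<And>u. (0::real) \<le> w\<^sub>2 u"
    "\<nu>\<^sub>1 = density S (\<lambda>u. ennreal (w\<^sub>1 u))" "\<nu>\<^sub>2 = density S (\<lambda>u. ennreal (w\<^sub>2 u))"
    "integrable S w\<^sub>1" "integrable S w\<^sub>2" "tv_dist \<nu>\<^sub>1 \<nu>\<^sub>2 = (\<integral>u. \<bar>w\<^sub>2 u - w\<^sub>1 u\<bar> \<partial>S)"
    by (rule tv_dist_densities[OF assms]) (rule that)
  define w\<^sub>0 where "w\<^sub>0 u = min (w\<^sub>1 u) (w\<^sub>2 u)" for u
  define \<nu>\<^sub>0 where "\<nu>\<^sub>0 = density S (\<lambda>u. ennreal (w\<^sub>0 u))"
  define \<rho> where "\<rho> w = density S (\<lambda>u. ennreal (w u - w\<^sub>0 u))" for w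
  have [measurable]: "w\<^sub>0 \<in> borel_measurable S" unfolding w\<^sub>0_def by measurable
  have w\<^sub>0: "0 \<le> w\<^sub>0 u" "w\<^sub>0 u \<le> w\<^sub>1 u" "w\<^sub>0 u \<le> w\<^sub>2 u" for u using w(1,2) by (auto simp: w\<^sub>0_def)
  have int0: "integrable S w\<^sub>0" unfolding w\<^sub>0_def using w(5,6) by simp
  have fin: "finite_measure (density S (\<lambda>u. ennreal (v u)))" if "integrable S v" "\<And>u. 0 \<le> v u" for v
  proof (rule finite_measureI)
    have "emeasure (density S (\<lambda>u. ennreal (v u))) (space S) = (\<integral>\<^sup>+u. ennreal (v u) \<partial>S)"
      using that(1) by (subst emeasure_density) (auto intro!: nn_integral_cong)
    also have "\<dots> = ennreal (\<integral>u. v u \<partial>S)"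
      using that by (intro nn_integral_eq_integral) auto
    finally show "emeasure (density S (\<lambda>u. ennreal (v u))) (space (density S (\<lambda>u. ennreal (v u)))) \<noteq> \<infinity>"
      by simp
  qed
  have dens: "(\<integral>\<^sup>+u. f u \<partial>density S (\<lambda>u. ennreal (v u))) = (\<integral>\<^sup>+u. ennreal (v u) * f u \<partial>S)"
    if "f \<in> borel_measurable S" "v \<in> borel_measurable S" for f and v :: "'a \<Rightarrow> real"
    using that by (intro nn_integral_density) auto
  have meas: "f \<in> borel_measurable S" if "f \<in> borel_measurable \<nu>\<^sub>1" for f :: "'a \<Rightarrow> ennreal"
    using that measurable_cong_sets[OF S refl] by blast
  have split: "(\<integral>\<^sup>+u. f u \<partial>density S (\<lambda>u. ennreal (w u))) = (\<integral>\<^sup>+u. f u \<partial>\<nu>\<^sub>0) + (\<integral>\<^sup>+u. f u \<partial>\<rho> w)"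
    if f: "f \<in> borel_measurable \<nu>\<^sub>1" and v [measurable]: "w \<in> borel_measurable S" and le: "\<And>u. w\<^sub>0 u \<le> w u" for f w
  proof -
    note [measurable] = meas[OF f]
    have "ennreal (w u) * f u = ennreal (w\<^sub>0 u) * f u + ennreal (w u - w\<^sub>0 u) * f u" for u
      using w\<^sub>0(1)[of u] le[of u] by (simp flip: distrib_right ennreal_plus)
    then show ?thesis unfolding \<nu>\<^sub>0_def \<rho>_def by (simp add: dens nn_integral_add)
  qed
  have tv: "(\<integral>\<^sup>+u. f u \<partial>\<rho> w\<^sub>1) + (\<integral>\<^sup>+u. f u \<partial>\<rho> w\<^sub>2) \<le> ennreal (tv_dist \<nu>\<^sub>1 \<nu>\<^sub>2)"
    if f: "f \<in> borel_measurable \<nu>\<^sub>1" and le: "\<forall>u\<in>space \<nu>\<^sub>1. f u \<le> 1" for f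
  proof -
    note [measurable] = meas[OF f]
    have "(\<integral>\<^sup>+u. f u \<partial>\<rho> w\<^sub>1) + (\<integral>\<^sup>+u. f u \<partial>\<rho> w\<^sub>2)
        = (\<integral>\<^sup>+u. ennreal (w\<^sub>1 u - w\<^sub>0 u) * f u + ennreal (w\<^sub>2 u - w\<^sub>0 u) * f u \<partial>S)"
      unfolding \<rho>_def by (simp add: dens nn_integral_add)
    also have "\<dots> \<le> (\<integral>\<^sup>+u. ennreal \<bar>w\<^sub>2 u - w\<^sub>1 u\<bar> \<partial>S)"
    proof (rule nn_integral_mono)
      fix u assume "u \<in> space S"
      then have fu: "f u \<le> 1" using le sets_eq_imp_space_eq[OF S] by auto
      \<comment> \<open>At each point one of the two residual densities is 0 and the other is the
        absolute difference.\<close>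
      have "ennreal (w\<^sub>1 u - w\<^sub>0 u) * f u + ennreal (w\<^sub>2 u - w\<^sub>0 u) * f u
          = ennreal \<bar>w\<^sub>2 u - w\<^sub>1 u\<bar> * f u"
        by (auto simp: w\<^sub>0_def min_def)
      also have "\<dots> \<le> ennreal \<bar>w\<^sub>2 u - w\<^sub>1 u\<bar> * 1" using fu by (intro mult_left_mono) auto
      finally show "ennreal (w\<^sub>1 u - w\<^sub>0 u) * f u + ennreal (w\<^sub>2 u - w\<^sub>0 u) * f u \<le> ennreal \<bar>w\<^sub>2 u - w\<^sub>1 u\<bar>"
        by simp
    qed
    also have "\<dots> = ennreal (tv_dist \<nu>\<^sub>1 \<nu>\<^sub>2)"
      unfolding w(7) using w(5,6) by (intro nn_integral_eq_integral) auto
    finally show ?thesis .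
  qed
  show thesis
  proof (rule that[of \<nu>\<^sub>0 "\<rho> w\<^sub>1" "\<rho> w\<^sub>2"])
    show "finite_measure \<nu>\<^sub>0" unfolding \<nu>\<^sub>0_def using int0 w\<^sub>0(1) by (rule fin)
    show "finite_measure (\<rho> w\<^sub>1)" "finite_measure (\<rho> w\<^sub>2)"
      unfolding \<rho>_def using int0 w(5,6) w\<^sub>0 by (auto intro!: fin)
    show "sets \<nu>\<^sub>0 = sets \<nu>\<^sub>1" "sets (\<rho> w\<^sub>1) = sets \<nu>\<^sub>1" "sets (\<rho> w\<^sub>2) = sets \<nu>\<^sub>1"
      using S by (simp_all add: \<nu>\<^sub>0_def \<rho>_def)
    show "(\<integral>\<^sup>+u. f u \<partial>\<nu>\<^sub>1) = (\<integral>\<^sup>+u. f u \<partial>\<nu>\<^sub>0) + (\<integral>\<^sup>+u. f u \<partial>\<rho> w\<^sub>1)" if "f \<in> borel_measurable \<nu>\<^sub>1" for f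
      by (subst w(3)) (rule split[OF that _ w\<^sub>0(2)], simp)
    show "(\<integral>\<^sup>+u. f u \<partial>\<nu>\<^sub>2) = (\<integral>\<^sup>+u. f u \<partial>\<nu>\<^sub>0) + (\<integral>\<^sup>+u. f u \<partial>\<rho> w\<^sub>2)" if "f \<in> borel_measurable \<nu>\<^sub>1" for f
      by (subst w(4)) (rule split[OF that _ w\<^sub>0(3)], simp)
  qed (rule tv)
qed

lemma integral_component_add:
  fixes \<nu> \<nu>\<^sub>0 \<rho> :: "(real ^ 'n::finite) measure"
  assumes "cube_measure \<nu> \<alpha>" "cube_measure \<nu>\<^sub>0 \<alpha>" "cube_measure \<rho> \<alpha>"
    and "\<And>f. f \<in> borel_measurable \<nu> \<Longrightarrow> (\<integral>\<^sup>+u. f u \<partial>\<nu>) = (\<integral>\<^sup>+u. f u \<partial>\<nu>\<^sub>0) + (\<integral>\<^sup>+u. f u \<partial>\<rho>)"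
  shows "(\<integral>u. u $ j \<partial>\<nu>) = (\<integral>u. u $ j \<partial>\<nu>\<^sub>0) + (\<integral>u. u $ j \<partial>\<rho>)"
proof -
  have eq: "(\<integral>\<^sup>+u. ennreal (u $ j) \<partial>m) = ennreal (\<integral>u. u $ j \<partial>m)" "0 \<le> (\<integral>u. u $ j \<partial>m)"
    if "cube_measure m \<alpha>" for m :: "(real ^ 'n) measure"
  proof -
    interpret cube_measure m \<alpha> by fact
    show "(\<integral>\<^sup>+u. ennreal (u $ j) \<partial>m) = ennreal (\<integral>u. u $ j \<partial>m)" "0 \<le> (\<integral>u. u $ j \<partial>m)"
      using component_bounds integrable_component
      by (auto intro!: nn_integral_eq_integral integral_nonneg_AE AE_I2)
  qed
  have "(\<lambda>u. ennreal (u $ j)) \<in> borel_measurable \<nu>"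
    using cube_measure.component_measurable[OF assms(1)] by simp
  from assms(4)[OF this] show ?thesis
    using eq[OF assms(1)] eq[OF assms(2)] eq[OF assms(3)] by (simp flip: ennreal_plus)
qed

text \<open>Passes from \<open>Z\<close> to its truncation, at cost \<epsilon> per coordinate, and
  from there to the law \<open>P\<close> of the common part. \<open>P\<close> is a parameter so that
  both max-stable vectors can be compared with the same law.\<close>

lemma expectation_max_stable_diff_le:
  fixes N :: "real ^ 'n::finite \<Rightarrow> real" and k :: "real ^ 'n \<Rightarrow> real"
  assumes "is_norm N" "pos_sphere N \<subseteq> {0..1}" "\<alpha> > 1" "angular_measure N \<nu>"
    and M: "prob_space M" and Z: "max_stable_rv \<alpha> \<nu> M Z" and \<epsilon>: "0 < \<epsilon>"
    and \<nu>\<^sub>0: "cube_measure \<nu>\<^sub>0 \<alpha>" and \<rho>: "cube_measure \<rho> \<alpha>"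
    and split: "\<And>f. f \<in> borel_measurable \<nu> \<Longrightarrow> (\<integral>\<^sup>+u. f u \<partial>\<nu>) = (\<integral>\<^sup>+u. f u \<partial>\<nu>\<^sub>0) + (\<integral>\<^sup>+u. f u \<partial>\<rho>)"
    and P: "max_stable_truncation \<alpha> \<epsilon> \<nu>\<^sub>0 P"
    and k: "\<And>x y. \<bar>k x - k y\<bar> \<le> norm1 (x - y)"
  shows "\<bar>(\<integral>\<omega>. k (Z \<omega>) \<partial>M) - (\<integral>x. k x \<partial>P)\<bar>
    \<le> real CARD('n) * \<epsilon> + (\<Sum>j\<in>UNIV. (\<integral>u. u $ j \<partial>\<rho>)) * Gamma (1 - 1 / \<alpha>)"
proof -
  have "\<alpha> > 0" using assms(3) by simp
  obtain Q where Q: "max_stable_truncation \<alpha> \<epsilon> \<rho> Q"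
    using cube_measure.max_stable_truncation_exists[OF \<rho> \<epsilon>] by blast
  have "cube_measure \<nu> \<alpha>"
    by (rule cube_measureI[OF _ sets_angular_measure[OF assms(4)] assms(2) \<open>\<alpha> > 0\<close>])
      (use assms(4) in \<open>simp add: angular_measure_def\<close>)
  from integral_component_add[OF this \<nu>\<^sub>0 \<rho> split]
  have mass: "(\<integral>u. u $ j \<partial>\<nu>\<^sub>0) + (\<integral>u. u $ j \<partial>\<rho>) = 1" for j
    using assms(4) by (simp add: angular_measure_def)
  note conv = expectation_sup_convolution_diff_le[OF \<nu>\<^sub>0 \<rho> P Q \<epsilon> assms(3) mass, of k, OF k]
  have Zm: "Z \<in> borel_measurable M" and Zpos: "\<And>\<omega>. \<omega> \<in> space M \<Longrightarrow> Z \<omega> \<in> pos_orthant"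
    using Z measurable_restrict_space2_iff[of Z M borel] by (auto simp: max_stable_rv_def)
  let ?Y = "\<lambda>\<omega>. sup (\<chi> j. \<epsilon>) (Z \<omega>)"
  have Ym: "?Y \<in> borel_measurable M"
    using measurable_compose[OF measurable_Pair[OF measurable_const Zm] borel_measurable_sup_vec] by simp
  have km: "k \<in> borel_measurable borel" using k by (rule borel_measurable_lipschitz_norm1)
  note law = law_of_truncated_max_stable[OF assms(1,2) \<open>\<alpha> > 0\<close> assms(4) M Z \<epsilon> \<nu>\<^sub>0 \<rho> split P Q]
  have int: "integrable M (\<lambda>\<omega>. k (?Y \<omega>))"
    using integrable_distr_eq[OF Ym km] conv(1) law by simp
  have eq: "(\<integral>\<omega>. k (?Y \<omega>) \<partial>M) = (\<integral>x. k x \<partial>sup_convolution P Q)"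
    using integral_distr[OF Ym km] law by simp
  have "0 \<le> Z \<omega>" if "\<omega> \<in> space M" for \<omega>
    using Zpos[OF that] by (auto simp: pos_orthant_def less_eq_vec_def intro: less_imp_le)
  then have "\<bar>(\<integral>\<omega>. k (Z \<omega>) \<partial>M) - (\<integral>\<omega>. k (?Y \<omega>) \<partial>M)\<bar> \<le> real CARD('n) * \<epsilon>"
    using \<epsilon> by (intro expectation_truncation_diff_le M Zm k int) auto
  then show ?thesis using conv(2) unfolding eq by linarith
qed

text \<open>Triangle inequality through the truncated law of the common part, after which the
  truncation level is absorbed into an arbitrary slack. Bounding the two residual moments jointly by
  \<open>tv_dist\<close> avoids a factor 2.\<close>

lemma expectation_diff_le_tv_dist:
  fixes N :: "real ^ 'n::finite \<Rightarrow> real" and k :: "real ^ 'n \<Rightarrow> real"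
  assumes "is_norm N" "pos_sphere N \<subseteq> {0..1}" "\<alpha> > 1"
    and "angular_measure N \<nu>\<^sub>1" "angular_measure N \<nu>\<^sub>2" "prob_space M\<^sub>1" "prob_space M\<^sub>2"
    and "max_stable_rv \<alpha> \<nu>\<^sub>1 M\<^sub>1 Z\<^sub>1" "max_stable_rv \<alpha> \<nu>\<^sub>2 M\<^sub>2 Z\<^sub>2"
    and k: "\<And>x y. \<bar>k x - k y\<bar> \<le> norm1 (x - y)"
  shows "\<bar>(\<integral>\<omega>. k (Z\<^sub>1 \<omega>) \<partial>M\<^sub>1) - (\<integral>\<omega>. k (Z\<^sub>2 \<omega>) \<partial>M\<^sub>2)\<bar>
    \<le> real CARD('n) * Gamma (1 - 1 / \<alpha>) * tv_dist \<nu>\<^sub>1 \<nu>\<^sub>2"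
proof (rule field_le_epsilon)
  fix \<delta> :: real assume "0 < \<delta>"
  \<comment> \<open>Each of the two vectors pays \<epsilon> in every coordinate, which makes
    \<delta> in total.\<close>
  define \<epsilon> where "\<epsilon> = \<delta> / (2 * real CARD('n))"
  have \<epsilon>: "0 < \<epsilon>" "2 * (real CARD('n) * \<epsilon>) = \<delta>" using \<open>0 < \<delta>\<close> by (auto simp: \<epsilon>_def)
  have \<nu>: "finite_measure \<nu>\<^sub>1" "finite_measure \<nu>\<^sub>2" "sets \<nu>\<^sub>2 = sets \<nu>\<^sub>1"
    "sets \<nu>\<^sub>1 = sets (restrict_space borel (pos_sphere N))"
    using assms(4,5) by (auto simp: angular_measure_def)
  have \<alpha>: "0 < \<alpha>" using assms(3) by simp
  obtain \<nu>\<^sub>0 \<rho>\<^sub>1 \<rho>\<^sub>2 where fin: "finite_measure \<nu>\<^sub>0" "finite_measure \<rho>\<^sub>1" "finite_measure \<rho>\<^sub>2"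
    and sets: "sets \<nu>\<^sub>0 = sets \<nu>\<^sub>1" "sets \<rho>\<^sub>1 = sets \<nu>\<^sub>1" "sets \<rho>\<^sub>2 = sets \<nu>\<^sub>1"
    and split1: "\<And>f. f \<in> borel_measurable \<nu>\<^sub>1 \<Longrightarrow> (\<integral>\<^sup>+u. f u \<partial>\<nu>\<^sub>1) = (\<integral>\<^sup>+u. f u \<partial>\<nu>\<^sub>0) + (\<integral>\<^sup>+u. f u \<partial>\<rho>\<^sub>1)"
    and split2: "\<And>f. f \<in> borel_measurable \<nu>\<^sub>1 \<Longrightarrow> (\<integral>\<^sup>+u. f u \<partial>\<nu>\<^sub>2) = (\<integral>\<^sup>+u. f u \<partial>\<nu>\<^sub>0) + (\<integral>\<^sup>+u. f u \<partial>\<rho>\<^sub>2)"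
    and tv: "\<And>f. f \<in> borel_measurable \<nu>\<^sub>1 \<Longrightarrow> \<forall>u\<in>space \<nu>\<^sub>1. f u \<le> 1 \<Longrightarrow>
      (\<integral>\<^sup>+u. f u \<partial>\<rho>\<^sub>1) + (\<integral>\<^sup>+u. f u \<partial>\<rho>\<^sub>2) \<le> ennreal (tv_dist \<nu>\<^sub>1 \<nu>\<^sub>2)"
    apply (rule common_part_decomposition[OF \<nu>(1-3)])
    subgoal for \<nu>\<^sub>0 \<rho>\<^sub>1 \<rho>\<^sub>2 by (rule that[of \<nu>\<^sub>0 \<rho>\<^sub>1 \<rho>\<^sub>2])
    done
  have cube: "cube_measure \<nu>\<^sub>0 \<alpha>" "cube_measure \<rho>\<^sub>1 \<alpha>" "cube_measure \<rho>\<^sub>2 \<alpha>" "cube_measure \<nu>\<^sub>1 \<alpha>"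
    using fin sets \<nu> assms(2) \<alpha> by (auto intro!: cube_measureI[where B="pos_sphere N"])
  interpret \<nu>\<^sub>1: cube_measure \<nu>\<^sub>1 \<alpha> by fact
  interpret \<rho>\<^sub>1: cube_measure \<rho>\<^sub>1 \<alpha> by fact
  interpret \<rho>\<^sub>2: cube_measure \<rho>\<^sub>2 \<alpha> by fact
  have split2': "\<And>f. f \<in> borel_measurable \<nu>\<^sub>2 \<Longrightarrow> (\<integral>\<^sup>+u. f u \<partial>\<nu>\<^sub>2) = (\<integral>\<^sup>+u. f u \<partial>\<nu>\<^sub>0) + (\<integral>\<^sup>+u. f u \<partial>\<rho>\<^sub>2)"
    using split2 measurable_cong_sets[OF \<nu>(3) refl] by blast
  obtain P where P: "max_stable_truncation \<alpha> \<epsilon> \<nu>\<^sub>0 P"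
    using cube_measure.max_stable_truncation_exists[OF cube(1) \<epsilon>(1)] by blast
  have bound: "(\<integral>u. u $ j \<partial>\<rho>\<^sub>1) + (\<integral>u. u $ j \<partial>\<rho>\<^sub>2) \<le> tv_dist \<nu>\<^sub>1 \<nu>\<^sub>2" for j
  proof -
    have nonneg: "0 \<le> (\<integral>u. u $ j \<partial>\<rho>\<^sub>1)" "0 \<le> (\<integral>u. u $ j \<partial>\<rho>\<^sub>2)"
      using \<rho>\<^sub>1.component_bounds \<rho>\<^sub>2.component_bounds by (auto intro!: integral_nonneg_AE AE_I2)
    have "ennreal ((\<integral>u. u $ j \<partial>\<rho>\<^sub>1) + (\<integral>u. u $ j \<partial>\<rho>\<^sub>2)) = (\<integral>\<^sup>+u. ennreal (u $ j) \<partial>\<rho>\<^sub>1) + (\<integral>\<^sup>+u. ennreal (u $ j) \<partial>\<rho>\<^sub>2)"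
      using nonneg \<rho>\<^sub>1.component_bounds \<rho>\<^sub>2.component_bounds \<rho>\<^sub>1.integrable_component \<rho>\<^sub>2.integrable_component
      by (subst (1 2) nn_integral_eq_integral) (auto intro!: AE_I2)
    also have "\<dots> \<le> ennreal (tv_dist \<nu>\<^sub>1 \<nu>\<^sub>2)"
      using \<nu>\<^sub>1.component_bounds \<nu>\<^sub>1.component_measurable by (intro tv) auto
    finally show ?thesis by (simp add: ennreal_le_iff tv_dist_nonneg)
  qed
  have G: "0 \<le> Gamma (1 - 1 / \<alpha>)" using assms(3) by (intro Gamma_real_nonneg) auto
  have "\<bar>(\<integral>\<omega>. k (Z\<^sub>1 \<omega>) \<partial>M\<^sub>1) - (\<integral>\<omega>. k (Z\<^sub>2 \<omega>) \<partial>M\<^sub>2)\<bar>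
      \<le> \<bar>(\<integral>\<omega>. k (Z\<^sub>1 \<omega>) \<partial>M\<^sub>1) - (\<integral>x. k x \<partial>P)\<bar> + \<bar>(\<integral>\<omega>. k (Z\<^sub>2 \<omega>) \<partial>M\<^sub>2) - (\<integral>x. k x \<partial>P)\<bar>"
    by simp
  also have "\<dots> \<le> (real CARD('n) * \<epsilon> + (\<Sum>j\<in>UNIV. (\<integral>u. u $ j \<partial>\<rho>\<^sub>1)) * Gamma (1 - 1 / \<alpha>))
      + (real CARD('n) * \<epsilon> + (\<Sum>j\<in>UNIV. (\<integral>u. u $ j \<partial>\<rho>\<^sub>2)) * Gamma (1 - 1 / \<alpha>))"
    by (intro add_mono
        expectation_max_stable_diff_le[OF assms(1-4,6,8) \<epsilon>(1) cube(1,2) split1 P k]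
        expectation_max_stable_diff_le[OF assms(1-3,5,7,9) \<epsilon>(1) cube(1,3) split2' P k])
  also have "\<dots> = (\<Sum>j\<in>UNIV. (\<integral>u. u $ j \<partial>\<rho>\<^sub>1) + (\<integral>u. u $ j \<partial>\<rho>\<^sub>2)) * Gamma (1 - 1 / \<alpha>) + \<delta>"
    by (simp add: sum.distrib distrib_right flip: \<epsilon>(2))
  also have "\<dots> \<le> (\<Sum>j\<in>(UNIV :: 'n set). tv_dist \<nu>\<^sub>1 \<nu>\<^sub>2) * Gamma (1 - 1 / \<alpha>) + \<delta>"
    by (intro add_right_mono mult_right_mono sum_mono bound G)
  finally show "\<bar>(\<integral>\<omega>. k (Z\<^sub>1 \<omega>) \<partial>M\<^sub>1) - (\<integral>\<omega>. k (Z\<^sub>2 \<omega>) \<partial>M\<^sub>2)\<bar>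
      \<le> real CARD('n) * Gamma (1 - 1 / \<alpha>) * tv_dist \<nu>\<^sub>1 \<nu>\<^sub>2 + \<delta>"
    by (simp add: mult_ac)
qed

text \<open>A test function is constrained on the closed orthant only. Composing it with the
  coordinate-wise positive part, which does not increase \<open>norm1\<close> distances, makes it
  globally Lipschitz without changing its values on the max-stable vectors.\<close>

lemma wasserstein_dist_max_stable_le:
  fixes N :: "real ^ 'n::finite \<Rightarrow> real"
  assumes "is_norm N" "pos_sphere N \<subseteq> {0..1}" "\<alpha> > 1"
    and "angular_measure N \<nu>\<^sub>1" "angular_measure N \<nu>\<^sub>2" "prob_space M\<^sub>1" "prob_space M\<^sub>2"
    and "max_stable_rv \<alpha> \<nu>\<^sub>1 M\<^sub>1 Z\<^sub>1" "max_stable_rv \<alpha> \<nu>\<^sub>2 M\<^sub>2 Z\<^sub>2"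
  shows "wasserstein_dist M\<^sub>1 Z\<^sub>1 M\<^sub>2 Z\<^sub>2 \<le> ereal (real CARD('n) * Gamma (1 - 1 / \<alpha>) * tv_dist \<nu>\<^sub>1 \<nu>\<^sub>2)"
  unfolding wasserstein_dist_def
proof (rule SUP_least)
  fix h :: "real ^ 'n \<Rightarrow> real" assume h: "h \<in> lip1_functions"
  define k where "k x = h (sup 0 x)" for x
  have "\<bar>k x - k y\<bar> \<le> norm1 (x - y)" for x y
  proof -
    have "sup 0 x \<in> nonneg_orthant" for x :: "real ^ 'n"
      by (simp add: nonneg_orthant_def sup_vec_def)
    then have "\<bar>k x - k y\<bar> \<le> norm1 (sup 0 x - sup 0 y)"
      using h unfolding k_def lip1_functions_def by blast
    also have "\<dots> \<le> norm1 (x - y)"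
      unfolding norm1_def by (intro sum_mono) (auto simp: sup_vec_def sup_max max_def)
    finally show ?thesis .
  qed
  note main = expectation_diff_le_tv_dist[OF assms this]
  have kZ: "(\<integral>\<omega>. k (Z \<omega>) \<partial>M) = (\<integral>\<omega>. h (Z \<omega>) \<partial>M)" if "max_stable_rv \<alpha> \<nu> M Z" for \<nu> and M :: "'c measure" and Z
  proof (rule Bochner_Integration.integral_cong)
    fix \<omega> assume "\<omega> \<in> space M"
    then have "Z \<omega> \<in> pos_orthant"
      using that measurable_space[of Z M "restrict_space borel pos_orthant"]
      by (auto simp: max_stable_rv_def space_restrict_space)
    then have "0 \<le> Z \<omega>" by (auto simp: pos_orthant_def less_eq_vec_def intro: less_imp_le)
    then show "k (Z \<omega>) = h (Z \<omega>)" by (simp add: k_def sup_absorb2)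
  qed simp
  show "ereal \<bar>(\<integral>\<omega>. h (Z\<^sub>1 \<omega>) \<partial>M\<^sub>1) - (\<integral>\<omega>. h (Z\<^sub>2 \<omega>) \<partial>M\<^sub>2)\<bar>
      \<le> ereal (real CARD('n) * Gamma (1 - 1 / \<alpha>) * tv_dist \<nu>\<^sub>1 \<nu>\<^sub>2)"
    using main kZ[OF assms(8)] kZ[OF assms(9)] by simp
qed

theorem theorem9:
  fixes N :: "real ^ 'n::finite \<Rightarrow> real"
    and \<alpha> :: real
    and \<nu>\<^sub>1 \<nu>\<^sub>2 :: "(real ^ 'n) measure"
    and M\<^sub>1 :: "'a measure" and Z\<^sub>1 :: "'a \<Rightarrow> real ^ 'n"
    and M\<^sub>2 :: "'b measure" and Z\<^sub>2 :: "'b \<Rightarrow> real ^ 'n"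
  assumes "is_norm N"
    and "pos_sphere N \<subseteq> {0..1}"
    and "\<alpha> > 0"
    and "angular_measure N \<nu>\<^sub>1" and "angular_measure N \<nu>\<^sub>2"
    and "prob_space M\<^sub>1" and "prob_space M\<^sub>2"
    and "max_stable_rv \<alpha> \<nu>\<^sub>1 M\<^sub>1 Z\<^sub>1" and "max_stable_rv \<alpha> \<nu>\<^sub>2 M\<^sub>2 Z\<^sub>2"
  shows "kolmogorov_dist M\<^sub>1 Z\<^sub>1 M\<^sub>2 Z\<^sub>2 \<le> real CARD('n) * tv_dist \<nu>\<^sub>1 \<nu>\<^sub>2 \<and>
         (\<alpha> > 1 \<longrightarrow>
            wasserstein_dist M\<^sub>1 Z\<^sub>1 M\<^sub>2 Z\<^sub>2
              \<le> ereal (real CARD('n) * Gamma (1 - 1 / \<alpha>) * tv_dist \<nu>\<^sub>1 \<nu>\<^sub>2))"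
proof (intro conjI impI)
  \<comment> \<open>The Kolmogorov bound is available with constant 1, and the dimension is at least
    1.\<close>
  have "1 * tv_dist \<nu>\<^sub>1 \<nu>\<^sub>2 \<le> real CARD('n) * tv_dist \<nu>\<^sub>1 \<nu>\<^sub>2"
    by (intro mult_right_mono tv_dist_nonneg) (simp add: Suc_le_eq)
  then show "kolmogorov_dist M\<^sub>1 Z\<^sub>1 M\<^sub>2 Z\<^sub>2 \<le> real CARD('n) * tv_dist \<nu>\<^sub>1 \<nu>\<^sub>2"
    using kolmogorov_dist_max_stable_le[OF assms(1-5,8,9)] by linarith
next
  assume "\<alpha> > 1"
  then show "wasserstein_dist M\<^sub>1 Z\<^sub>1 M\<^sub>2 Z\<^sub>2 \<le> ereal (real CARD('n) * Gamma (1 - 1 / \<alpha>) * tv_dist \<nu>\<^sub>1 \<nu>\<^sub>2)"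
    by (rule wasserstein_dist_max_stable_le[OF assms(1,2) _ assms(4-9)])
qed

end
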